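(* Let $H$ be the Gårding–Wightman module associated to a triple $(\mu,\nu,\{c_k\})$. If $\mu$ is discrete and $H$ is irreducible over $\mathbb C$, then $H$ is irreducible over $\mathbb R$. In particular, this is the case for the Fermi–Fock representation, i.e. the module associated to the triple $(\mu,1,1)$ (with $\nu\equiv 1$ and $c_k\equiv 1$ for all $k$), where $\mu(\{\delta\})=1$ for all $\delta\in\Delta$ and $\mu(X\setminus\Delta)=0$.
   Context: $Z$ is an infinite-dimensional real separable Hilbert space, and $C(Z)$ is its Clifford algebra: the quotient of the real tensor algebra of $Z$ by the ideal generated by the elements $zw+wz+2(z,w)1$, $z,w\in Z$; $C_{\mathbb C}(Z)=\mathbb C\otimes C(Z)$. Fix an orthogonal complex structure $\sigma$ on $Z$ and a unitary basis $z_1,z_2,\dots$ of $(Z,\sigma)$, so that $\{z_k,\sigma(z_k)\}_{k\in\mathbb N}$ is a real orthonormal basis of $Z$. $X$ is the set of sequences $x=(x_1,x_2,\dots)$ with $x_k\in\{0,1\}$, a group under componentwise addition mod 2; $\delta_k\in X$ has $k$-th entry $1$ and all others $0$; $\Delta\subset X$ is the (countable) subgroup of sequences with finitely many $1$'s. $X$ carries the $\sigma$-algebra generated by the sets $X_k=\{x: x_k=1\}$. A Gårding–Wightman (GW) triple $(\mu,\nu,\{c_k\})$ consists of: (a) a nonzero $\sigma$-finite positive measure $\mu$ on $X$, quasi-invariant under $\Delta$: for each $\delta\in\Delta$ the measure $\mu_\delta(E)=\mu(E+\delta)$ has the same null sets as $\mu$; write $\frac{d\mu(x+\delta)}{d\mu(x)}$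 for $\frac{d\mu_\delta}{d\mu}(x)$; (b) a measurable function $\nu:X\to\{1,2,\dots\}\cup\{\infty\}$ with $\nu(x+\delta)=\nu(x)$ for all $\delta\in\Delta$ and almost all $x$; (c) fixing for each $n$ a separable complex Hilbert space $\mathcal H_n$ of dimension $n$ and setting $H_x=\mathcal H_{\nu(x)}$ (so $H_{x+\delta}=H_x$ for $\delta\in\Delta$ and a.e. $x$), unitary operators $c_k(x):H_x\to H_{x+\delta_k}=H_x$, depending measurably on $x$, with $c_k(x)^*=c_k(x+\delta_k)$ and $c_k(x)c_l(x+\delta_k)=c_l(x)c_k(x+\delta_l)$ for all $k,l$ and almost all $x$. The associated GW module is the Hilbert space $H=\int_X^{\oplus}H_x\,d\mu(x)$ with the continuous representation $\mathbb J$ of $C_{\mathbb C}(Z)$, where $Z$ acts by skew-hermitian operators $\mathbb J_z$ (real linear in $z$), determined by $$(\mathbb J_{z_k}f)(x)=(-1)^{x_1+\dots+x_{k-1}+1}\,i\,c_k(x)\sqrt{\tfrac{d\mu(x+\delta_k)}{d\mu(x)}}\,f(x+\delta_k),\qquad (\mathbb J_{\sigma(z_k)}f)(x)=(-1)^{x_k}\,i\,(\mathbb J_{z_k}f)(x).$$ $\mu$ is discrete if it is concentrated on a countable set (a sum of point masses). $H$ is irreducible over $\mathbb C$ (resp. over $\mathbb R$) if the only closed complex (resp. real) linear subspaces of $H$ invariant under all $\mathbb J_z$, $z\in Z$, are $\{0\}$ and $H$. *)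

theory Defs
  imports "HOL-Analysis.Analysis" "HOL-Library.Function_Algebras" "HOL-Library.Z2"
    "HOL-Library.Extended_Nat"
begin

section \<open>Complex Hilbert spaces\<close>

text \<open>The Hermitian product is linear in the first argument; its real part is the inner product of
  the underlying real Hilbert space, so norm and topology are those of the library.\<close>

class complex_hilbert = real_inner + banach +
  fixes scaleC :: "complex \<Rightarrow> 'a \<Rightarrow> 'a"  (infixr "*\<^sub>C" 75)
    and cinner :: "'a \<Rightarrow> 'a \<Rightarrow> complex"
  assumes scaleC_add_right: "a *\<^sub>C (x + y) = a *\<^sub>C x + a *\<^sub>C y"
    and scaleC_add_left: "(a + b) *\<^sub>C x = a *\<^sub>C x + b *\<^sub>C x"
    and scaleC_scaleC: "a *\<^sub>C (b *\<^sub>C x) = (a * b) *\<^sub>C x"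
    and scaleC_of_real: "complex_of_real r *\<^sub>C x = r *\<^sub>R x"
    and cinner_commute: "cinner x y = cnj (cinner y x)"
    and cinner_add_left: "cinner (x + y) z = cinner x z + cinner y z"
    and cinner_scaleC_left: "cinner (a *\<^sub>C x) y = a * cinner x y"
    and Re_cinner: "Re (cinner x y) = inner x y"

definition closed_csubspace :: "'h::complex_hilbert set \<Rightarrow> bool" where
  "closed_csubspace S \<longleftrightarrow> module.subspace scaleC S \<and> closed S"

definition has_hilbert_dim :: "'h::complex_hilbert set \<Rightarrow> enat \<Rightarrow> bool" where
  "has_hilbert_dim S n \<longleftrightarrow>
     (\<exists>B\<subseteq>S. (\<forall>u\<in>B. \<forall>v\<in>B. cinner u v = (if u = v then 1 else 0)) \<and>
        closure (module.span scaleC B) = S \<and>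
        (case n of enat m \<Rightarrow> finite B \<and> card B = m | \<infinity> \<Rightarrow> infinite B))"

definition unitary_on :: "'h::complex_hilbert set \<Rightarrow> ('h \<Rightarrow> 'h) \<Rightarrow> bool" where
  "unitary_on S U \<longleftrightarrow>
     (\<forall>u\<in>S. \<forall>v\<in>S. U (u + v) = U u + U v) \<and> (\<forall>a. \<forall>u\<in>S. U (a *\<^sub>C u) = a *\<^sub>C U u) \<and>
     (\<forall>u\<in>S. \<forall>v\<in>S. cinner (U u) (U v) = cinner u v) \<and> U ` S = S"

section \<open>The one-particle space\<close>

definition orthogonal_complex_structure :: "('z::real_inner \<Rightarrow> 'z) \<Rightarrow> bool" where
  "orthogonal_complex_structure \<sigma> \<longleftrightarrow>
     linear \<sigma> \<and> (\<forall>u v. inner (\<sigma> u) (\<sigma> v) = inner u v) \<and> (\<forall>u. \<sigma> (\<sigma> u) = - u)"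

text \<open>The Hermitian product of the complex Hilbert space in which \<open>\<sigma>\<close> is multiplication by
  \<open>\<i>\<close>, linear in the first argument.\<close>

definition herm :: "('z::real_inner \<Rightarrow> 'z) \<Rightarrow> 'z \<Rightarrow> 'z \<Rightarrow> complex" where
  "herm \<sigma> u v = Complex (inner u v) (inner u (\<sigma> v))"

text \<open>The complex span of the basis is the real span of the basis and its image under \<open>\<sigma>\<close>.\<close>

definition unitary_basis :: "('z::real_inner \<Rightarrow> 'z) \<Rightarrow> (nat \<Rightarrow> 'z) \<Rightarrow> bool" where
  "unitary_basis \<sigma> e \<longleftrightarrow>
     (\<forall>k l. herm \<sigma> (e k) (e l) = (if k = l then 1 else 0)) \<and>
     closure (span (range e \<union> range (\<lambda>k. \<sigma> (e k)))) = UNIV"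

section \<open>The sequence space\<close>

text \<open>All indices are shifted by one: the entry \<open>x k\<close> and the basis vector \<open>e k\<close> are the entry
  and the basis vector with number \<open>k + 1\<close> in the convention that starts at \<open>1\<close>.
  Addition of sequences is pointwise.\<close>

type_synonym seq = "nat \<Rightarrow> bit"

definition delta :: "nat \<Rightarrow> seq" where
  "delta k = (\<lambda>j. if j = k then 1 else 0)"

definition Delta :: "seq set" where
  "Delta = {x. finite {k. x k = 1}}"

definition seq_space :: "seq measure" where
  "seq_space = sigma UNIV (range (\<lambda>k. {x. x k = 1}))"

text \<open>Translation by \<open>\<delta>\<close> is an involution, so the preimage of \<open>E\<close> under it is \<open>E + \<delta>\<close>.\<close>

definition translate :: "seq measure \<Rightarrow> seq \<Rightarrow> seq measure" where
  "translate \<mu> \<delta> = distr \<mu> \<mu> (\<lambda>x. x + \<delta>)"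

definition quasi_invariant :: "seq measure \<Rightarrow> bool" where
  "quasi_invariant \<mu> \<longleftrightarrow> (\<forall>\<delta>\<in>Delta. null_sets (translate \<mu> \<delta>) = null_sets \<mu>)"

definition discrete_measure :: "seq measure \<Rightarrow> bool" where
  "discrete_measure \<mu> \<longleftrightarrow> (\<exists>A. countable A \<and> (AE x in \<mu>. x \<in> A))"

section \<open>Garding-Wightman triples\<close>

text \<open>\<open>\<H> n\<close> is the chosen Hilbert space of dimension \<open>n\<close>, realised as a closed subspace of an
  ambient separable complex Hilbert space.\<close>

definition gw_triple ::
  "(enat \<Rightarrow> 'h::{complex_hilbert,second_countable_topology} set) \<Rightarrow> seq measure \<Rightarrow> (seq \<Rightarrow> enat) \<Rightarrow>
   (nat \<Rightarrow> seq \<Rightarrow> 'h \<Rightarrow> 'h) \<Rightarrow> bool" where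
  "gw_triple \<H> \<mu> \<nu> c \<longleftrightarrow>
     space \<mu> = UNIV \<and> sets \<mu> = sets seq_space \<and> emeasure \<mu> UNIV \<noteq> 0 \<and>
     sigma_finite_measure \<mu> \<and> quasi_invariant \<mu> \<and>
     \<nu> \<in> measurable \<mu> (count_space UNIV) \<and> (\<forall>x. \<nu> x \<ge> 1) \<and>
     (\<forall>\<delta>\<in>Delta. AE x in \<mu>. \<nu> (x + \<delta>) = \<nu> x) \<and>
     (\<forall>k. AE x in \<mu>. unitary_on (\<H> (\<nu> x)) (c k x)) \<and>
     (\<forall>k n. \<forall>v\<in>\<H> n.
        (\<lambda>x. c k x v) \<in> borel_measurable (restrict_space \<mu> {x. \<nu> x = n})) \<and>
     (\<forall>k. AE x in \<mu>. \<forall>u\<in>\<H> (\<nu> x). \<forall>v\<in>\<H> (\<nu> x).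
        cinner (c k x u) v = cinner u (c k (x + delta k) v)) \<and>
     (\<forall>k l. AE x in \<mu>. \<forall>v\<in>\<H> (\<nu> x).
        c k x (c l (x + delta k) v) = c l x (c k (x + delta l) v))"

section \<open>The module of a triple\<close>

text \<open>Elements of the direct integral are represented by square-integrable sections; equality in
  the direct integral is equality almost everywhere. Since \<open>\<nu>\<close> is invariant only almost
  everywhere, sections take values in the fibres almost everywhere, and they are measurable for
  the completion of \<open>\<mu>\<close>, so that changes on null sets are harmless.\<close>

definition gw_space ::
  "(enat \<Rightarrow> 'h::{complex_hilbert,second_countable_topology} set) \<Rightarrow> seq measure \<Rightarrow> (seq \<Rightarrow> enat) \<Rightarrow>
   (seq \<Rightarrow> 'h) set" where
  "gw_space \<H> \<mu> \<nu> =
     {f. f \<in> borel_measurable (completion \<mu>) \<and> (AE x in \<mu>. f x \<in> \<H> (\<nu> x)) \<and>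
         (\<integral>\<^sup>+ x. ennreal ((norm (f x))\<^sup>2) \<partial>completion \<mu>) < \<infinity>}"

definition l2_tendsto ::
  "seq measure \<Rightarrow> (nat \<Rightarrow> seq \<Rightarrow> 'h::complex_hilbert) \<Rightarrow> (seq \<Rightarrow> 'h) \<Rightarrow> bool" where
  "l2_tendsto \<mu> F g \<longleftrightarrow>
     (\<lambda>n. \<integral>\<^sup>+ x. ennreal ((norm (F n x - g x))\<^sup>2) \<partial>completion \<mu>) \<longlonglongrightarrow> 0"

definition gw_J_basis ::
  "seq measure \<Rightarrow> (nat \<Rightarrow> seq \<Rightarrow> 'h \<Rightarrow> 'h) \<Rightarrow> nat \<Rightarrow> (seq \<Rightarrow> 'h::complex_hilbert) \<Rightarrow> seq \<Rightarrow> 'h" where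
  "gw_J_basis \<mu> c k f = (\<lambda>x.
     ((- 1) ^ ((\<Sum>j<k. of_bool (x j = 1)) + 1) * \<i> *
        complex_of_real (sqrt (enn2real (RN_deriv \<mu> (translate \<mu> (delta k)) x))))
     *\<^sub>C c k x (f (x + delta k)))"

definition gw_J_sigma_basis ::
  "seq measure \<Rightarrow> (nat \<Rightarrow> seq \<Rightarrow> 'h \<Rightarrow> 'h) \<Rightarrow> nat \<Rightarrow> (seq \<Rightarrow> 'h::complex_hilbert) \<Rightarrow> seq \<Rightarrow> 'h" where
  "gw_J_sigma_basis \<mu> c k f =
     (\<lambda>x. ((- 1) ^ of_bool (x k = 1) * \<i>) *\<^sub>C gw_J_basis \<mu> c k f x)"

text \<open>\<open>gw_J \<H> \<mu> \<nu> c \<sigma> e z f g\<close> says that \<open>g\<close> represents the image of \<open>f\<close> under the operator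
  of \<open>z\<close>. As this operator depends real-linearly and continuously on \<open>z\<close> (the Clifford relations
  make its norm equal to the norm of \<open>z\<close>), it is the limit of the operators of the partial sums
  of the expansion of \<open>z\<close> in the real orthonormal basis \<open>e k, \<sigma> (e k)\<close>. It is a relation because
  \<open>g\<close> is determined only up to null sets.\<close>

definition gw_J ::
  "(enat \<Rightarrow> 'h::{complex_hilbert,second_countable_topology} set) \<Rightarrow> seq measure \<Rightarrow> (seq \<Rightarrow> enat) \<Rightarrow>
   (nat \<Rightarrow> seq \<Rightarrow> 'h \<Rightarrow> 'h) \<Rightarrow> ('z::real_inner \<Rightarrow> 'z) \<Rightarrow> (nat \<Rightarrow> 'z) \<Rightarrow>
   'z \<Rightarrow> (seq \<Rightarrow> 'h) \<Rightarrow> (seq \<Rightarrow> 'h) \<Rightarrow> bool" where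
  "gw_J \<H> \<mu> \<nu> c \<sigma> e z f g \<longleftrightarrow>
     g \<in> gw_space \<H> \<mu> \<nu> \<and>
     l2_tendsto \<mu> (\<lambda>n x. \<Sum>k<n. inner z (e k) *\<^sub>R gw_J_basis \<mu> c k f x +
                                inner z (\<sigma> (e k)) *\<^sub>R gw_J_sigma_basis \<mu> c k f x) g"

text \<open>Sets of sections that are closed for the mean-square seminorm are automatically saturated for
  equality almost everywhere, so they correspond to the closed subsets of the direct integral.\<close>

definition gw_closed_real_subspace ::
  "(enat \<Rightarrow> 'h::{complex_hilbert,second_countable_topology} set) \<Rightarrow> seq measure \<Rightarrow> (seq \<Rightarrow> enat) \<Rightarrow>
   (seq \<Rightarrow> 'h) set \<Rightarrow> bool" where
  "gw_closed_real_subspace \<H> \<mu> \<nu> W \<longleftrightarrow>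
     W \<subseteq> gw_space \<H> \<mu> \<nu> \<and> (\<lambda>x. 0) \<in> W \<and>
     (\<forall>f\<in>W. \<forall>g\<in>W. (\<lambda>x. f x + g x) \<in> W) \<and>
     (\<forall>r::real. \<forall>f\<in>W. (\<lambda>x. r *\<^sub>R f x) \<in> W) \<and>
     (\<forall>F g. (\<forall>n. F n \<in> W) \<longrightarrow> g \<in> gw_space \<H> \<mu> \<nu> \<longrightarrow> l2_tendsto \<mu> F g \<longrightarrow> g \<in> W)"

definition gw_closed_complex_subspace ::
  "(enat \<Rightarrow> 'h::{complex_hilbert,second_countable_topology} set) \<Rightarrow> seq measure \<Rightarrow> (seq \<Rightarrow> enat) \<Rightarrow>
   (seq \<Rightarrow> 'h) set \<Rightarrow> bool" where
  "gw_closed_complex_subspace \<H> \<mu> \<nu> W \<longleftrightarrow>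
     gw_closed_real_subspace \<H> \<mu> \<nu> W \<and> (\<forall>a::complex. \<forall>f\<in>W. (\<lambda>x. a *\<^sub>C f x) \<in> W)"

definition gw_invariant ::
  "(enat \<Rightarrow> 'h::{complex_hilbert,second_countable_topology} set) \<Rightarrow> seq measure \<Rightarrow> (seq \<Rightarrow> enat) \<Rightarrow>
   (nat \<Rightarrow> seq \<Rightarrow> 'h \<Rightarrow> 'h) \<Rightarrow> ('z::real_inner \<Rightarrow> 'z) \<Rightarrow> (nat \<Rightarrow> 'z) \<Rightarrow> (seq \<Rightarrow> 'h) set \<Rightarrow> bool" where
  "gw_invariant \<H> \<mu> \<nu> c \<sigma> e W \<longleftrightarrow> (\<forall>z. \<forall>f\<in>W. \<forall>g. gw_J \<H> \<mu> \<nu> c \<sigma> e z f g \<longrightarrow> g \<in> W)"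

definition gw_irreducible_real ::
  "(enat \<Rightarrow> 'h::{complex_hilbert,second_countable_topology} set) \<Rightarrow> seq measure \<Rightarrow> (seq \<Rightarrow> enat) \<Rightarrow>
   (nat \<Rightarrow> seq \<Rightarrow> 'h \<Rightarrow> 'h) \<Rightarrow> ('z::real_inner \<Rightarrow> 'z) \<Rightarrow> (nat \<Rightarrow> 'z) \<Rightarrow> bool" where
  "gw_irreducible_real \<H> \<mu> \<nu> c \<sigma> e \<longleftrightarrow>
     (\<forall>W. gw_closed_real_subspace \<H> \<mu> \<nu> W \<longrightarrow> gw_invariant \<H> \<mu> \<nu> c \<sigma> e W \<longrightarrow>
        W = {f \<in> gw_space \<H> \<mu> \<nu>. AE x in \<mu>. f x = 0} \<or> W = gw_space \<H> \<mu> \<nu>)"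

definition gw_irreducible_complex ::
  "(enat \<Rightarrow> 'h::{complex_hilbert,second_countable_topology} set) \<Rightarrow> seq measure \<Rightarrow> (seq \<Rightarrow> enat) \<Rightarrow>
   (nat \<Rightarrow> seq \<Rightarrow> 'h \<Rightarrow> 'h) \<Rightarrow> ('z::real_inner \<Rightarrow> 'z) \<Rightarrow> (nat \<Rightarrow> 'z) \<Rightarrow> bool" where
  "gw_irreducible_complex \<H> \<mu> \<nu> c \<sigma> e \<longleftrightarrow>
     (\<forall>W. gw_closed_complex_subspace \<H> \<mu> \<nu> W \<longrightarrow> gw_invariant \<H> \<mu> \<nu> c \<sigma> e W \<longrightarrow>
        W = {f \<in> gw_space \<H> \<mu> \<nu>. AE x in \<mu>. f x = 0} \<or> W = gw_space \<H> \<mu> \<nu>)"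

section \<open>The Fermi-Fock measure\<close>

definition fock_measure :: "seq measure" where
  "fock_measure = distr (count_space Delta) seq_space (\<lambda>x. x)"

lemma space_seq_space: "space seq_space = UNIV"
  by (simp add: seq_space_def)

lemma coordinate_sets: "{x. x k = b} \<in> sets seq_space"
proof -
  have 1: "{x. x k = 1} \<in> sets seq_space" for k
    by (simp add: seq_space_def)
  have "{x. x k = 0} = space seq_space - {x::seq. x k = 1}"
    by (auto simp: space_seq_space)
  then have "{x. x k = 0} \<in> sets seq_space"
    using 1 by (metis sets.compl_sets)
  then show ?thesis
    using 1 by (cases b) auto
qed

lemma singleton_sets: "{a} \<in> sets seq_space"
proof -
  have "{a} = (\<Inter>k. {x. x k = a k})"
    by auto
  also have "\<dots> \<in> sets seq_space"
    by (intro sets.countable_INT) (auto simp only: coordinate_sets)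
  finally show ?thesis .
qed

lemma countable_Delta: "countable Delta"
proof -
  have "countable {A::nat set. finite A}"
    by (rule countable_Collect_finite)
  then have "countable ((\<lambda>A k. if k \<in> A then 1 else 0 :: bit) ` {A::nat set. finite A})"
    by (rule countable_image)
  moreover have "Delta \<subseteq> (\<lambda>A k. if k \<in> A then 1 else 0 :: bit) ` {A::nat set. finite A}"
  proof
    fix x assume "x \<in> Delta"
    moreover have "x = (\<lambda>k. if k \<in> {k. x k = 1} then 1 else 0)"
      by (auto simp: fun_eq_iff)
    ultimately show "x \<in> (\<lambda>A k. if k \<in> A then 1 else 0 :: bit) ` {A::nat set. finite A}"
      unfolding Delta_def by blast
  qed
  ultimately show ?thesis
    by (rule countable_subset[rotated])
qed

lemma Delta_sets: "Delta \<in> sets seq_space"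
  by (rule sets.countable[OF singleton_sets countable_Delta])

lemma fock_measure_singleton:
  assumes "\<delta> \<in> Delta"
  shows "emeasure fock_measure {\<delta>} = 1"
proof -
  have "emeasure fock_measure {\<delta>} =
      emeasure (count_space Delta) ((\<lambda>x. x) -` {\<delta>} \<inter> space (count_space Delta))"
    unfolding fock_measure_def
    by (rule emeasure_distr) (simp_all only: singleton_sets measurable_count_space_eq1,
        simp only: space_seq_space Pi_UNIV UNIV_I)
  also have "(\<lambda>x. x) -` {\<delta>} \<inter> space (count_space Delta) = {\<delta>}"
    using assms by (simp only: space_count_space) blast
  also have "emeasure (count_space Delta) {\<delta>} = 1"
    using assms by (simp add: emeasure_count_space_finite)
  finally show ?thesis .
qed

lemma fock_measure_off_Delta: "emeasure fock_measure (- Delta) = 0"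
proof -
  have "- Delta \<in> sets seq_space"
    using Delta_sets by (metis Compl_eq_Diff_UNIV sets.compl_sets space_seq_space)
  then show ?thesis
    by (subst fock_measure_def, subst emeasure_distr) (auto simp: space_seq_space)
qed

end

theory Submission
  imports Defs
begin

text \<open>
  Write \<open>J\<^sub>k\<close> and \<open>J'\<^sub>k\<close> for the operators of \<open>e k\<close> and \<open>\<sigma> (e k)\<close>. Since \<open>J'\<^sub>k\<close> is
  \<open>J\<^sub>k\<close> followed by multiplication by \<open>\<i> (-1)\<^bsup>x k\<^esup>\<close>, and \<open>J\<^sub>k\<close> flips the coordinate \<open>k\<close> and has
  square \<open>-1\<close>, the product \<open>T\<^sub>k = J\<^sub>k J'\<^sub>k\<close> is multiplication by \<open>\<i> (-1)\<^bsup>x k\<^esup>\<close>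
  (lemma \<open>J_J_sigma\<close>). A closed real subspace \<open>W\<close> that is invariant under the generators is
  therefore invariant under \<open>- T\<^sub>j T\<^sub>k\<close>, which multiplies by the real sign
  \<open>(-1)\<^bsup>x j + x k\<^esup>\<close>, and so under restriction of sections to the set of \<open>x\<close> that agree with a
  given atom \<open>a\<close> in both of the coordinates \<open>0\<close> and \<open>k\<close> or in neither of them. Letting \<open>k\<close> run
  through all indices, the limit of these restrictions is the restriction to two points, \<open>a\<close> and
  the sequence \<open>a'\<close> that differs from \<open>a\<close> everywhere (lemma \<open>W_restrict_pair\<close>).

  If the module is irreducible over the complex numbers, then the atoms form a single orbit of the
  group of finitely supported sequences (lemma \<open>single_orbit\<close>). As \<open>a'\<close> is in another orbit, it
  has mass \<open>0\<close>, so \<open>W\<close> is invariant under restriction to the single point \<open>a\<close>. There \<open>T\<^sub>0\<close> is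
  multiplication by \<open>\<i>\<close> or by \<open>- \<i>\<close>. A section is the sum of its restrictions to the countably
  many atoms, so \<open>W\<close> is closed under multiplication by \<open>\<i>\<close> (lemma \<open>W_complex\<close>): it is a complex
  subspace, and irreducibility over the complex numbers applies to it.

  The Fock measure has the single orbit of \<open>0\<close> as its atoms, and its fibres are one-dimensional. If
  an invariant closed complex subspace contains a section with a nonzero value at \<open>a\<close>, then it
  contains all sections supported on \<open>a\<close>; the generators carry these to all sections supported on
  one atom (lemma \<open>W_point_orbit\<close>), and these span a dense subspace of the module.
\<close>

section \<open>Complex scalars\<close>

interpretation cvec: vector_space "scaleC :: complex \<Rightarrow> 'h::complex_hilbert \<Rightarrow> 'h"
proof
  show "1 *\<^sub>C x = x" for x :: 'h
    using scaleC_of_real[of 1 x] by simp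
qed (simp_all add: scaleC_add_right scaleC_add_left scaleC_scaleC)

lemma cinner_self: "cinner x x = complex_of_real ((norm x)\<^sup>2)"
proof -
  have "Im (cinner x x) = 0"
    using arg_cong[OF cinner_commute[of x x], of Im] by simp
  then show ?thesis
    by (simp add: complex_eq_iff Re_cinner power2_norm_eq_inner)
qed

lemma cinner_scaleC_right: "cinner x (a *\<^sub>C y) = cnj a * cinner x y"
  by (metis cinner_commute cinner_scaleC_left complex_cnj_mult)

lemma norm_scaleC: "norm (a *\<^sub>C x) = cmod a * norm (x :: 'h::complex_hilbert)"
proof -
  have "complex_of_real ((norm (a *\<^sub>C x))\<^sup>2) = (a * cnj a) * complex_of_real ((norm x)\<^sup>2)"
    unfolding cinner_self[symmetric] cinner_scaleC_left cinner_scaleC_right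
    by (simp only: mult.assoc mult.left_commute)
  also have "\<dots> = complex_of_real ((cmod a * norm x)\<^sup>2)"
    by (simp only: complex_norm_square[symmetric] of_real_mult[symmetric] power_mult_distrib)
  finally have "complex_of_real ((norm (a *\<^sub>C x))\<^sup>2) = complex_of_real ((cmod a * norm x)\<^sup>2)" .
  then show ?thesis
    by (simp only: of_real_eq_iff) (simp add: power2_eq_iff_nonneg)
qed

lemma cinner_ext:
  assumes "cvec.subspace S" "p \<in> S" "q \<in> S" "\<And>u. u \<in> S \<Longrightarrow> cinner u p = cinner u q"
  shows "p = q"
proof -
  have "p - q \<in> S"
    using assms by (blast intro: cvec.subspace_diff)
  then have "Re (cinner (p - q) p) = Re (cinner (p - q) q)"
    using assms(4) by simp
  then have "inner (p - q) (p - q) = 0"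
    by (simp add: Re_cinner inner_diff_right)
  then show ?thesis by simp
qed

text \<open>A one-dimensional Hilbert space is the set of multiples of each of its nonzero vectors; the
  closure in the definition of the dimension adds nothing to a complex line.\<close>

lemma hilbert_dim_1_multiple:
  assumes "has_hilbert_dim S 1" "v \<in> S" "w \<in> S" "v \<noteq> 0"
  shows "\<exists>a. w = a *\<^sub>C v"
proof -
  obtain u where u: "cinner u u = 1" and S: "closure (cvec.span {u}) = S"
    using assms(1) by (auto simp: has_hilbert_dim_def one_enat_def card_1_singleton_iff)
  have "norm u = 1"
    using u norm_ge_zero[of u] unfolding cinner_self of_real_eq_1_iff power2_eq_1_iff by linarith
  then have nu: "norm (a *\<^sub>C u) = cmod a" for a
    by (simp add: norm_scaleC)
  have "bounded_linear (\<lambda>a. a *\<^sub>C u)"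
  proof (rule bounded_linear_intro[where K = 1])
    show "(r *\<^sub>R a) *\<^sub>C u = r *\<^sub>R (a *\<^sub>C u)" for r a
      by (simp only: scaleR_conv_of_real scaleC_scaleC[symmetric] scaleC_of_real)
  qed (simp_all add: nu scaleC_add_left)
  then have "complete (range (\<lambda>a. a *\<^sub>C u))"
    by (intro complete_isometric_image[of 1]) (auto simp: nu complete_UNIV)
  then have "closed (range (\<lambda>a. a *\<^sub>C u))"
    by (rule complete_imp_closed)
  moreover have "cvec.span {u} = range (\<lambda>a. a *\<^sub>C u)"
    by (rule cvec.span_singleton)
  ultimately have "S = range (\<lambda>a. a *\<^sub>C u)"
    using S by simp
  then obtain a b where ab: "v = a *\<^sub>C u" "w = b *\<^sub>C u"
    using assms(2,3) by blast
  then have "a \<noteq> 0" using assms(4) by auto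
  then have "w = (b / a) *\<^sub>C v"
    using ab by (simp add: scaleC_scaleC)
  then show ?thesis by blast
qed

section \<open>Translations of the sequence space\<close>

lemma add_delta_cancel [simp]: "x + \<delta> + \<delta> = (x :: seq)"
proof
  have "a + b + b = a" for a b :: bit
    by (cases a; cases b) simp_all
  then show "(x + \<delta> + \<delta>) j = x j" for j
    by (simp only: plus_fun_apply)
qed

lemma delta_Delta: "delta k \<in> Delta"
proof -
  have "{j. delta k j = 1} = {k}" by (auto simp: delta_def)
  then show ?thesis by (simp add: Delta_def)
qed

lemma Delta_add:
  assumes "x \<in> Delta" "y \<in> Delta"
  shows "x + y \<in> Delta"
proof -
  have "{k. (x + y) k = 1} \<subseteq> {k. x k = 1} \<union> {k. y k = 1}"
    by auto
  then show ?thesis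
    using assms unfolding Delta_def by (auto intro: finite_subset)
qed

lemma add_delta_self: "(x + delta k) k = x k + 1"
  and add_delta_other: "j \<noteq> k \<Longrightarrow> (x + delta k) j = x j"
  by (simp_all add: delta_def)

lemma measurable_translation: "(\<lambda>x. x + \<delta>) \<in> measurable seq_space seq_space"
proof -
  have "{x :: seq. x k + \<delta> k = 1} \<in> sets seq_space" for k
  proof -
    have "{x :: seq. x k + \<delta> k = 1} = {x. x k = 1 + \<delta> k}"
      by (auto simp: set_eq_iff)
    then show ?thesis using coordinate_sets by metis
  qed
  then show ?thesis
    unfolding seq_space_def
    by (intro measurable_measure_of) (auto simp: seq_space_def vimage_def)
qed

section \<open>Triples over a discrete measure\<close>

text \<open>The hypotheses on the fibres are those under which \<open>\<H> n\<close> is a Hilbert space of dimension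
  \<open>n\<close>; \<open>\<nu>\<close> never takes the value \<open>0\<close>, so nothing is required of \<open>\<H> 0\<close>.\<close>

locale discrete_gw_triple =
  fixes \<H> :: "enat \<Rightarrow> 'h::{complex_hilbert,second_countable_topology} set"
    and \<mu> :: "seq measure" and \<nu> :: "seq \<Rightarrow> enat" and c :: "nat \<Rightarrow> seq \<Rightarrow> 'h \<Rightarrow> 'h"
  assumes triple: "gw_triple \<H> \<mu> \<nu> c"
    and discrete: "discrete_measure \<mu>"
    and fibre: "\<And>n. n \<ge> 1 \<Longrightarrow> closed_csubspace (\<H> n)"
    and fibre_dim: "\<And>n. n \<ge> 1 \<Longrightarrow> has_hilbert_dim (\<H> n) n"
begin

lemma space_mu: "space \<mu> = UNIV" and sets_mu: "sets \<mu> = sets seq_space"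
  and mu_nonzero: "emeasure \<mu> UNIV \<noteq> 0"
  and mu_sigma_finite: "sigma_finite_measure \<mu>" and mu_quasi: "quasi_invariant \<mu>"
  and nu_ge_1: "\<nu> x \<ge> 1"
  using triple by (auto simp: gw_triple_def)

lemma singleton_mu: "{x} \<in> sets \<mu>"
  by (simp add: sets_mu singleton_sets)

abbreviation weight :: "seq \<Rightarrow> ennreal" where "weight x \<equiv> emeasure \<mu> {x}"

text \<open>The atoms are the points of positive mass. Almost everywhere means at every atom, so all
  identities between sections need to be checked only there.\<close>

definition atoms :: "seq set" where "atoms = {x. weight x \<noteq> 0}"

lemma AE_iff_atoms: "(AE x in \<mu>. P x) \<longleftrightarrow> (\<forall>x\<in>atoms. P x)"
proof
  assume "AE x in \<mu>. P x"
  then obtain N where N: "{x \<in> space \<mu>. \<not> P x} \<subseteq> N" "emeasure \<mu> N = 0" "N \<in> sets \<mu>"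
    by (rule AE_E)
  show "\<forall>x\<in>atoms. P x"
  proof (intro ballI, rule ccontr)
    fix x assume x: "x \<in> atoms" "\<not> P x"
    then have "{x} \<subseteq> N" using N(1) space_mu by auto
    then have "weight x \<le> emeasure \<mu> N" using N(3) by (rule emeasure_mono)
    then show False using N(2) x(1) by (simp add: atoms_def)
  qed
next
  assume P: "\<forall>x\<in>atoms. P x"
  obtain A where A: "countable A" "AE x in \<mu>. x \<in> A"
    using discrete by (auto simp: discrete_measure_def)
  have "countable (A - atoms)" using A(1) by simp
  then have "(\<Union>x\<in>A - atoms. {x}) \<in> null_sets \<mu>"
    by (rule null_sets_UN') (auto simp: null_sets_def singleton_mu atoms_def)
  then have "AE x in \<mu>. x \<notin> (\<Union>x\<in>A - atoms. {x})"
    by (rule AE_not_in)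
  with A(2) show "AE x in \<mu>. P x"
    using P by (auto elim: AE_mp)
qed

lemma countable_atoms: "countable atoms"
proof -
  obtain A where A: "countable A" "AE x in \<mu>. x \<in> A"
    using discrete by (auto simp: discrete_measure_def)
  then have "atoms \<subseteq> A" by (auto simp: AE_iff_atoms)
  then show ?thesis using A(1) by (rule countable_subset)
qed

lemma atoms_nonempty: "atoms \<noteq> {}"
proof
  assume "atoms = {}"
  then have "AE x in \<mu>. False" by (simp add: AE_iff_atoms)
  moreover have "UNIV \<in> sets \<mu>"
    using sets.top[of \<mu>] by (simp add: space_mu)
  ultimately have "UNIV \<in> null_sets \<mu>"
    by (subst AE_iff_null_sets) auto
  then show False
    using mu_nonzero by auto
qed

text \<open>Completing a discrete measure makes every set measurable, so that integration becomes
  weighted summation.\<close>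

lemma completion_eq: "completion \<mu> = density (count_space UNIV) weight"
proof (rule measure_eqI)
  have "S \<in> sets (completion \<mu>)" for S
  proof -
    have 1: "S \<inter> atoms \<in> sets \<mu>"
      by (rule sets.countable) (auto simp: singleton_mu countable_atoms)
    have "AE x in \<mu>. x \<notin> S - atoms" by (simp add: AE_iff_atoms)
    then obtain N where "{x \<in> space \<mu>. \<not> x \<notin> S - atoms} \<subseteq> N" "emeasure \<mu> N = 0" "N \<in> sets \<mu>"
      by (rule AE_E)
    then have "S - atoms \<in> sets (completion \<mu>)"
      by (intro sets_completionI_sub[of N]) (auto simp: space_mu)
    then have "(S \<inter> atoms) \<union> (S - atoms) \<in> sets (completion \<mu>)"
      using 1 by (intro sets.Un) auto
    then show ?thesis by (simp add: Int_Diff_Un)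
  qed
  then show sets: "sets (completion \<mu>) = sets (density (count_space UNIV) weight)"
    by auto
  fix S assume "S \<in> sets (completion \<mu>)"
  have 1: "S \<inter> atoms \<in> sets \<mu>"
    by (rule sets.countable) (auto simp: singleton_mu countable_atoms)
  have "AE x in completion \<mu>. x \<in> S \<longleftrightarrow> x \<in> S \<inter> atoms"
    by (rule AE_completion) (simp add: AE_iff_atoms)
  then have "emeasure (completion \<mu>) S = emeasure (completion \<mu>) (S \<inter> atoms)"
    by (rule emeasure_eq_AE) (auto simp: sets)
  also have "\<dots> = emeasure \<mu> (S \<inter> atoms)"
    using 1 by simp
  also have "\<dots> = (\<integral>\<^sup>+ x. weight x \<partial>count_space (S \<inter> atoms))"
    by (rule emeasure_countable_singleton) (auto simp: singleton_mu countable_atoms)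
  also have "\<dots> = (\<integral>\<^sup>+ x. weight x * indicator S x \<partial>count_space UNIV)"
    by (subst nn_integral_count_space_indicator)
      (auto intro!: nn_integral_cong simp: atoms_def indicator_def)
  also have "\<dots> = emeasure (density (count_space UNIV) weight) S"
    by (simp add: emeasure_density)
  finally show "emeasure (completion \<mu>) S = emeasure (density (count_space UNIV) weight) S" .
qed

lemma measurable_all: "f \<in> borel_measurable (completion \<mu>)"
  by (simp add: completion_eq)

lemma nn_integral_atoms:
  "(\<integral>\<^sup>+ x. g x \<partial>completion \<mu>) = (\<integral>\<^sup>+ x. weight x * g x \<partial>count_space UNIV)"
  unfolding completion_eq by (rule nn_integral_density) auto

lemma gw_space_iff:
  "f \<in> gw_space \<H> \<mu> \<nu> \<longleftrightarrow> (\<forall>x\<in>atoms. f x \<in> \<H> (\<nu> x)) \<and>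
     (\<integral>\<^sup>+ x. ennreal ((norm (f x))\<^sup>2) \<partial>completion \<mu>) < \<infinity>"
  by (simp add: gw_space_def measurable_all AE_iff_atoms)

lemma AE_completion_atoms: "\<forall>x\<in>atoms. P x \<Longrightarrow> AE x in completion \<mu>. P x"
  by (rule AE_completion) (simp add: AE_iff_atoms)

lemma fibre_subspace: "cvec.subspace (\<H> (\<nu> x))"
  using fibre[OF nu_ge_1] by (simp add: closed_csubspace_def)

lemma fibre_0: "0 \<in> \<H> (\<nu> x)"
  by (rule cvec.subspace_0[OF fibre_subspace])

lemma fibre_scaleC: "v \<in> \<H> (\<nu> x) \<Longrightarrow> a *\<^sub>C v \<in> \<H> (\<nu> x)"
  by (rule cvec.subspace_scale[OF fibre_subspace])

text \<open>Measurability being automatic, a section with values in the fibres belongs to the module as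
  soon as it is dominated by a section of the module.\<close>

lemma gw_space_dominated:
  assumes f: "f \<in> gw_space \<H> \<mu> \<nu>"
    and g: "\<And>x. x \<in> atoms \<Longrightarrow> g x \<in> \<H> (\<nu> x)"
      "\<And>x. x \<in> atoms \<Longrightarrow> norm (g x) \<le> C * norm (f x)"
  shows "g \<in> gw_space \<H> \<mu> \<nu>"
proof -
  have "ennreal ((norm (g x))\<^sup>2) \<le> ennreal (C\<^sup>2) * ennreal ((norm (f x))\<^sup>2)" if "x \<in> atoms" for x
    using power_mono[OF g(2)[OF that] norm_ge_zero, of 2]
    by (simp add: power_mult_distrib ennreal_leI flip: ennreal_mult)
  then have "(\<integral>\<^sup>+ x. ennreal ((norm (g x))\<^sup>2) \<partial>completion \<mu>)
      \<le> (\<integral>\<^sup>+ x. ennreal (C\<^sup>2) * ennreal ((norm (f x))\<^sup>2) \<partial>completion \<mu>)"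
    by (intro nn_integral_mono_AE AE_completion_atoms) auto
  also have "\<dots> = ennreal (C\<^sup>2) * (\<integral>\<^sup>+ x. ennreal ((norm (f x))\<^sup>2) \<partial>completion \<mu>)"
    by (rule nn_integral_cmult) (rule measurable_all)
  also have "\<dots> < \<infinity>"
    using f by (auto simp: gw_space_iff ennreal_mult_less_top)
  finally show ?thesis
    using g(1) by (simp add: gw_space_iff)
qed

lemma gw_space_restrict:
  "f \<in> gw_space \<H> \<mu> \<nu> \<Longrightarrow> (\<lambda>x. if x \<in> E then f x else 0) \<in> gw_space \<H> \<mu> \<nu>"
  by (rule gw_space_dominated[of f _ 1]) (auto simp: gw_space_iff fibre_0)

text \<open>Atoms have finite mass because \<open>\<mu>\<close> is \<open>\<sigma>\<close>-finite.\<close>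

lemma weight_finite: "weight x \<noteq> \<infinity>"
proof -
  obtain A where A: "range A \<subseteq> sets \<mu>" "(\<Union>i. A i) = space \<mu>" "\<And>i::nat. emeasure \<mu> (A i) \<noteq> \<infinity>"
    using sigma_finite_measure.sigma_finite[OF mu_sigma_finite] by metis
  then obtain i where "x \<in> A i" using space_mu by blast
  then have "weight x \<le> emeasure \<mu> (A i)"
    using A(1) by (intro emeasure_mono) auto
  then show ?thesis using A(3)[of i] by (auto simp: top_unique)
qed

lemma gw_space_point:
  assumes "v \<in> \<H> (\<nu> a)"
  shows "(\<lambda>x. if x = a then v else 0) \<in> gw_space \<H> \<mu> \<nu>"
proof -
  have "(\<integral>\<^sup>+ x. ennreal ((norm (if x = a then v else 0))\<^sup>2) \<partial>completion \<mu>)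
      = (\<integral>\<^sup>+ x. ennreal ((norm v)\<^sup>2) * indicator {a} x \<partial>completion \<mu>)"
    by (intro nn_integral_cong) (auto simp: indicator_def)
  also have "\<dots> = ennreal ((norm v)\<^sup>2) * weight a"
    by (subst nn_integral_cmult_indicator) (auto simp: completion_eq singleton_mu emeasure_density)
  also have "\<dots> < \<infinity>"
    using weight_finite[of a] by (auto simp: ennreal_mult_less_top top.not_eq_extremum)
  finally show ?thesis
    using assms by (auto simp: gw_space_iff fibre_0)
qed

text \<open>Mean-square convergence implies convergence at each atom, since the square of the error there
  is at most the integral divided by the mass of the atom. The converse holds under domination.\<close>

lemma l2_tendsto_pointwise:
  assumes "l2_tendsto \<mu> F g" "x \<in> atoms"
  shows "(\<lambda>n. F n x) \<longlonglongrightarrow> g x"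
proof -
  let ?m = "measure \<mu> {x}"
  have m: "weight x = ennreal ?m" "?m > 0"
  proof -
    show "weight x = ennreal ?m"
      using weight_finite[of x] by (intro emeasure_eq_ennreal_measure) simp
    then have "?m \<noteq> 0"
      using assms(2) by (auto simp: atoms_def)
    then show "?m > 0"
      by (simp add: zero_less_measure_iff)
  qed
  have le: "ennreal (?m * (norm (F n x - g x))\<^sup>2)
      \<le> (\<integral>\<^sup>+ x. ennreal ((norm (F n x - g x))\<^sup>2) \<partial>completion \<mu>)" for n
  proof -
    have "ennreal (?m * (norm (F n x - g x))\<^sup>2)
        = weight x * ennreal ((norm (F n x - g x))\<^sup>2)"
      by (simp add: m(1) ennreal_mult)
    also have "\<dots> \<le> (\<integral>\<^sup>+ y. weight y * ennreal ((norm (F n y - g y))\<^sup>2) \<partial>count_space UNIV)"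
      by (rule nn_integral_ge_point) simp
    finally show ?thesis by (simp add: nn_integral_atoms)
  qed
  have "(\<lambda>n. ennreal (?m * (norm (F n x - g x))\<^sup>2)) \<longlonglongrightarrow> 0"
    by (rule tendsto_sandwich[OF _ _ tendsto_const assms(1)[unfolded l2_tendsto_def]])
      (simp_all add: le)
  then have "(\<lambda>n. ?m * (norm (F n x - g x))\<^sup>2) \<longlonglongrightarrow> 0"
    by (subst (asm) ennreal_0[symmetric], subst (asm) tendsto_ennreal_iff) auto
  then have "(\<lambda>n. (?m * (norm (F n x - g x))\<^sup>2) / ?m) \<longlonglongrightarrow> 0 / ?m"
    by (intro tendsto_divide tendsto_const) (use m in auto)
  then have "(\<lambda>n. (norm (F n x - g x))\<^sup>2) \<longlonglongrightarrow> 0"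
    using m(2) by simp
  then have "(\<lambda>n. sqrt ((norm (F n x - g x))\<^sup>2)) \<longlonglongrightarrow> sqrt 0"
    by (rule tendsto_real_sqrt)
  then show ?thesis
    by (simp add: LIM_zero_iff tendsto_norm_zero_iff)
qed

lemma l2_tendsto_dominated:
  assumes f: "f \<in> gw_space \<H> \<mu> \<nu>"
    and F: "\<And>n x. x \<in> atoms \<Longrightarrow> norm (F n x) \<le> norm (f x)"
    and lim: "\<And>x. x \<in> atoms \<Longrightarrow> (\<lambda>n. F n x) \<longlonglongrightarrow> g x"
  shows "l2_tendsto \<mu> F g"
proof -
  have g: "norm (g x) \<le> norm (f x)" if "x \<in> atoms" for x
    by (rule LIMSEQ_le_const2[OF tendsto_norm[OF lim[OF that]]]) (use F that in blast)
  have le: "ennreal ((norm (F n x - g x))\<^sup>2) \<le> 4 * ennreal ((norm (f x))\<^sup>2)" if "x \<in> atoms" for n x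
  proof -
    have "norm (F n x - g x) \<le> 2 * norm (f x)"
      using F[OF that, of n] g[OF that] norm_triangle_ineq4[of "F n x" "g x"] by linarith
    then have "(norm (F n x - g x))\<^sup>2 \<le> (2 * norm (f x))\<^sup>2"
      by (intro power_mono) auto
    then have "ennreal ((norm (F n x - g x))\<^sup>2) \<le> ennreal (4 * (norm (f x))\<^sup>2)"
      by (intro ennreal_leI) (simp add: power_mult_distrib)
    then show ?thesis by (simp add: ennreal_mult)
  qed
  have "(\<lambda>n. \<integral>\<^sup>+ x. ennreal ((norm (F n x - g x))\<^sup>2) \<partial>completion \<mu>)
      \<longlonglongrightarrow> (\<integral>\<^sup>+ x. 0 \<partial>completion \<mu>)"
  proof (rule nn_integral_dominated_convergence[where w = "\<lambda>x. 4 * ennreal ((norm (f x))\<^sup>2)"])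
    show "(\<integral>\<^sup>+ x. 4 * ennreal ((norm (f x))\<^sup>2) \<partial>completion \<mu>) < \<infinity>"
      using f by (subst nn_integral_cmult[OF measurable_all])
        (auto simp: gw_space_iff ennreal_mult_less_top)
    show "AE x in completion \<mu>. (\<lambda>n. ennreal ((norm (F n x - g x))\<^sup>2)) \<longlonglongrightarrow> 0"
    proof (rule AE_completion_atoms, intro ballI)
      fix x assume "x \<in> atoms"
      then have "(\<lambda>n. ennreal ((norm (F n x - g x))\<^sup>2)) \<longlonglongrightarrow> ennreal ((norm (g x - g x))\<^sup>2)"
        by (intro tendsto_intros lim)
      then show "(\<lambda>n. ennreal ((norm (F n x - g x))\<^sup>2)) \<longlonglongrightarrow> 0" by simp
    qed
    show "AE x in completion \<mu>. ennreal ((norm (F n x - g x))\<^sup>2) \<le> 4 * ennreal ((norm (f x))\<^sup>2)" for n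
      using le by (intro AE_completion_atoms) auto
  qed (auto simp: measurable_all)
  then show ?thesis by (simp add: l2_tendsto_def)
qed

lemma closed_dominated:
  assumes "gw_closed_real_subspace \<H> \<mu> \<nu> W" "\<And>n. F n \<in> W"
    and "g \<in> gw_space \<H> \<mu> \<nu>" "f \<in> gw_space \<H> \<mu> \<nu>"
    and "\<And>n x. x \<in> atoms \<Longrightarrow> norm (F n x) \<le> norm (f x)"
    and "\<And>x. x \<in> atoms \<Longrightarrow> (\<lambda>n. F n x) \<longlonglongrightarrow> g x"
  shows "g \<in> W"
  using assms l2_tendsto_dominated[of f F g] unfolding gw_closed_real_subspace_def by blast

text \<open>Equality at the atoms is equality almost everywhere; closed subspaces cannot tell the two
  sections apart.\<close>

lemma closed_saturated:
  assumes W: "gw_closed_real_subspace \<H> \<mu> \<nu> W" and f: "f \<in> W"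
    and eq: "\<And>x. x \<in> atoms \<Longrightarrow> g x = f x"
  shows "g \<in> W"
proof -
  have "f \<in> gw_space \<H> \<mu> \<nu>"
    using W f by (auto simp: gw_closed_real_subspace_def)
  moreover from this have "g \<in> gw_space \<H> \<mu> \<nu>"
    by (intro gw_space_dominated[of f g 1]) (auto simp: eq gw_space_iff)
  ultimately show ?thesis
    by (intro closed_dominated[OF W, of "\<lambda>_. f" g f]) (auto simp: f eq)
qed

section \<open>The generators\<close>

lemma translate_atom: "emeasure (translate \<mu> \<delta>) {x} = weight (x + \<delta>)"
proof -
  have "emeasure (translate \<mu> \<delta>) {x} = emeasure \<mu> ((\<lambda>x. x + \<delta>) -` {x} \<inter> space \<mu>)"
    unfolding translate_def
    using measurable_translation
    by (intro emeasure_distr) (simp_all add: singleton_mu measurable_cong_sets[OF sets_mu sets_mu])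
  also have "(\<lambda>x. x + \<delta>) -` {x} \<inter> space \<mu> = {x + \<delta>}"
    by (auto simp: space_mu)
  finally show ?thesis .
qed

lemma atoms_translate:
  assumes "\<delta> \<in> Delta"
  shows "x + \<delta> \<in> atoms \<longleftrightarrow> x \<in> atoms"
proof -
  have "{x} \<in> null_sets (translate \<mu> \<delta>) \<longleftrightarrow> {x} \<in> null_sets \<mu>"
    using mu_quasi assms by (simp add: quasi_invariant_def)
  then show ?thesis
    by (simp add: null_sets_def translate_atom singleton_mu atoms_def)
      (simp add: translate_def singleton_mu)
qed

lemmas atoms_delta = atoms_translate[OF delta_Delta]

lemma atoms_orbit:
  assumes "a \<in> atoms" "finite {j. b j \<noteq> a j}"
  shows "b \<in> atoms"
proof -
  have "(a j + b j = 1) = (b j \<noteq> a j)" for j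
    by (cases "a j"; cases "b j") simp_all
  then have "a + b \<in> Delta"
    using assms(2) by (simp only: Delta_def mem_Collect_eq plus_fun_apply)
  then have "a + (a + b) \<in> atoms"
    using assms(1) atoms_translate by blast
  moreover have "a + (a + b) = b"
    by (metis add.commute add_delta_cancel)
  ultimately show ?thesis by (simp only:)
qed

text \<open>At an atom the Radon-Nikodym derivative of the translated measure is a quotient of masses.\<close>

lemma RN_deriv_atom:
  assumes "x \<in> atoms"
  shows "weight x * RN_deriv \<mu> (translate \<mu> (delta k)) x = weight (x + delta k)"
proof -
  let ?N = "translate \<mu> (delta k)"
  have "density \<mu> (RN_deriv \<mu> ?N) = ?N"
    by (rule sigma_finite_measure.density_RN_deriv[OF mu_sigma_finite])
      (use mu_quasi delta_Delta in
        \<open>auto simp: absolutely_continuous_def quasi_invariant_def translate_def\<close>)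
  then have "weight (x + delta k) = emeasure (density \<mu> (RN_deriv \<mu> ?N)) {x}"
    by (simp add: translate_atom)
  also have "\<dots> = (\<integral>\<^sup>+ y. RN_deriv \<mu> ?N y * indicator {x} y \<partial>\<mu>)"
    by (rule emeasure_density) (auto simp: singleton_mu)
  also have "\<dots> = (\<integral>\<^sup>+ y. RN_deriv \<mu> ?N x * indicator {x} y \<partial>\<mu>)"
    by (rule nn_integral_cong) (auto simp: indicator_def)
  also have "\<dots> = RN_deriv \<mu> ?N x * weight x"
    by (simp add: nn_integral_cmult_indicator singleton_mu)
  finally show ?thesis by (simp add: mult.commute)
qed

text \<open>The Radon-Nikodym derivative of the translate by \<open>delta k\<close>, as a real number. The library
  operator returns an extended nonnegative real, which is finite at the atoms.\<close>

definition jac :: "nat \<Rightarrow> seq \<Rightarrow> real" where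
  "jac k x = enn2real (RN_deriv \<mu> (translate \<mu> (delta k)) x)"

lemma jac_atom:
  assumes "x \<in> atoms"
  shows "weight x * ennreal (jac k x) = weight (x + delta k)"
proof -
  have "RN_deriv \<mu> (translate \<mu> (delta k)) x \<noteq> \<infinity>"
    using RN_deriv_atom[OF assms, of k] weight_finite[of "x + delta k"] assms
    by (auto simp: atoms_def ennreal_mult_eq_top_iff)
  then show ?thesis
    using RN_deriv_atom[OF assms, of k] by (simp add: jac_def top.not_eq_extremum)
qed

lemma jac_nonneg: "jac k x \<ge> 0"
  by (simp add: jac_def)

lemma jac_delta:
  assumes "x \<in> atoms"
  shows "jac k x * jac k (x + delta k) = 1"
proof -
  have "weight x * (ennreal (jac k x) * ennreal (jac k (x + delta k))) = weight x * 1"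
    using jac_atom[OF assms, of k] jac_atom[of "x + delta k" k] assms
    by (simp add: atoms_delta mult.assoc[symmetric])
  then have "ennreal (jac k x) * ennreal (jac k (x + delta k)) = 1"
    using assms weight_finite[of x]
    by (subst (asm) ennreal_mult_cancel_left) (auto simp: atoms_def)
  then have "ennreal (jac k x * jac k (x + delta k)) = ennreal 1"
    by (simp add: ennreal_mult jac_nonneg)
  then show ?thesis
    by (subst (asm) ennreal_inj) (auto simp: jac_nonneg)
qed

lemma nu_delta: "x \<in> atoms \<Longrightarrow> \<nu> (x + delta k) = \<nu> x"
  using triple delta_Delta by (auto simp: gw_triple_def AE_iff_atoms)

lemma c_unitary: "x \<in> atoms \<Longrightarrow> unitary_on (\<H> (\<nu> x)) (c k x)"
  using triple by (auto simp: gw_triple_def AE_iff_atoms)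

lemma c_closed: "x \<in> atoms \<Longrightarrow> v \<in> \<H> (\<nu> x) \<Longrightarrow> c k x v \<in> \<H> (\<nu> x)"
  using c_unitary[of x k] unfolding unitary_on_def by blast

lemma c_norm: "x \<in> atoms \<Longrightarrow> v \<in> \<H> (\<nu> x) \<Longrightarrow> norm (c k x v) = norm v"
proof -
  assume "x \<in> atoms" "v \<in> \<H> (\<nu> x)"
  then have "cinner (c k x v) (c k x v) = cinner v v"
    using c_unitary[of x k] unfolding unitary_on_def by blast
  then show ?thesis
    by (simp only: cinner_self of_real_eq_iff) (simp add: power2_eq_iff_nonneg)
qed

lemma c_scaleC: "x \<in> atoms \<Longrightarrow> v \<in> \<H> (\<nu> x) \<Longrightarrow> c k x (a *\<^sub>C v) = a *\<^sub>C c k x v"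
  using c_unitary[of x k] unfolding unitary_on_def by blast

lemma c_0: "x \<in> atoms \<Longrightarrow> c k x 0 = 0"
  using c_norm[OF _ fibre_0, of x k] by simp

text \<open>Unitarity turns the adjointness relation between \<open>c k x\<close> and \<open>c k (x + delta k)\<close> into the
  statement that these operators are inverse to each other.\<close>

lemma c_inverse:
  assumes x: "x \<in> atoms" and v: "v \<in> \<H> (\<nu> x)"
  shows "c k x (c k (x + delta k) v) = v"
proof (rule cinner_ext[OF fibre_subspace[of x]])
  let ?y = "x + delta k"
  have y: "?y \<in> atoms" "\<nu> ?y = \<nu> x" using x by (simp_all add: atoms_delta nu_delta)
  have cv: "c k ?y v \<in> \<H> (\<nu> x)" using c_closed[OF y(1)] v y(2) by simp
  show "c k x (c k ?y v) \<in> \<H> (\<nu> x)" using x cv by (rule c_closed)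
  show "v \<in> \<H> (\<nu> x)" by (rule v)
  fix u assume u: "u \<in> \<H> (\<nu> x)"
  have adj: "\<forall>u\<in>\<H> (\<nu> ?y). \<forall>w\<in>\<H> (\<nu> ?y). cinner (c k ?y u) w = cinner u (c k (?y + delta k) w)"
    using triple y(1) unfolding gw_triple_def AE_iff_atoms by blast
  then have "cinner u (c k x (c k ?y v)) = cinner (c k ?y u) (c k ?y v)"
    using u cv y(2) by simp
  also have "\<dots> = cinner u v"
    using c_unitary[OF y(1), of k] u v y(2) unfolding unitary_on_def by auto
  finally show "cinner u (c k x (c k ?y v)) = cinner u v" .
qed

text \<open>The sign \<open>(-1)\<close> to the power \<open>x 0 + \<dots> + x (k - 1) + 1\<close> in the formula for the operator of
  \<open>e k\<close>, and the sign \<open>(-1)\<close> to the power \<open>b\<close>.\<close>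

definition jsign :: "nat \<Rightarrow> seq \<Rightarrow> real" where
  "jsign k x = (- 1) ^ ((\<Sum>j<k. of_bool (x j = 1)) + 1)"

definition bsign :: "bit \<Rightarrow> real" where "bsign b = (if b = 1 then - 1 else 1)"

lemma gw_J_basis_eq:
  "gw_J_basis \<mu> c k f x = (jsign k x * \<i> * sqrt (jac k x)) *\<^sub>C c k x (f (x + delta k))"
  by (simp add: gw_J_basis_def jsign_def jac_def)

lemma gw_J_sigma_basis_eq:
  "gw_J_sigma_basis \<mu> c k f x = (bsign (x k) * \<i>) *\<^sub>C gw_J_basis \<mu> c k f x"
  by (simp add: gw_J_sigma_basis_def bsign_def)

lemma jsign_square: "jsign k x * jsign k x = 1"
  unfolding jsign_def by (simp flip: power_mult_distrib)

lemma jsign_delta: "jsign k (x + delta k) = jsign k x"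
proof -
  have "(\<Sum>j<k. of_bool ((x + delta k) j = 1)) = (\<Sum>j<k. of_bool (x j = 1) :: nat)"
    by (rule sum.cong) (simp_all add: add_delta_other del: plus_fun_apply)
  then show ?thesis by (simp only: jsign_def)
qed

lemma bsign_add_1: "bsign (b + 1) = - bsign b"
  by (cases b) (simp_all add: bsign_def)

lemma bsign_delta: "bsign ((x + delta k) k) = - bsign (x k)"
  by (simp only: add_delta_self bsign_add_1)

lemma abs_bsign: "\<bar>bsign b\<bar> = 1" and abs_jsign: "\<bar>jsign k x\<bar> = 1"
  by (simp_all add: bsign_def jsign_def power_abs)

text \<open>The operators of the basis vectors preserve the norm: the Jacobian factor compensates for the
  translation in the sum over the atoms.\<close>

lemma gw_space_J:
  assumes "f \<in> gw_space \<H> \<mu> \<nu>"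
  shows "gw_J_basis \<mu> c k f \<in> gw_space \<H> \<mu> \<nu>"
  unfolding gw_space_iff
proof
  have f: "f (x + delta k) \<in> \<H> (\<nu> x)" if "x \<in> atoms" for x
    using assms that unfolding gw_space_iff by (metis atoms_delta nu_delta)
  then show "\<forall>x\<in>atoms. gw_J_basis \<mu> c k f x \<in> \<H> (\<nu> x)"
    by (auto simp: gw_J_basis_eq intro!: fibre_scaleC c_closed)
  have "weight x * ennreal ((norm (gw_J_basis \<mu> c k f x))\<^sup>2)
      = weight (x + delta k) * ennreal ((norm (f (x + delta k)))\<^sup>2)" for x
  proof (cases "x \<in> atoms")
    case True
    then have "(norm (gw_J_basis \<mu> c k f x))\<^sup>2 = jac k x * (norm (f (x + delta k)))\<^sup>2"
      using f jac_nonneg by (simp add: gw_J_basis_eq norm_scaleC norm_mult abs_jsign c_norm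
          power_mult_distrib)
    then show ?thesis
      using jac_atom[OF True, of k] jac_nonneg
      by (simp add: ennreal_mult mult.assoc[symmetric])
  next
    case False
    moreover from this have "x + delta k \<notin> atoms" by (simp add: atoms_delta)
    ultimately show ?thesis by (simp add: atoms_def)
  qed
  then have "(\<integral>\<^sup>+ x. ennreal ((norm (gw_J_basis \<mu> c k f x))\<^sup>2) \<partial>completion \<mu>)
      = (\<integral>\<^sup>+ x. weight (x + delta k) * ennreal ((norm (f (x + delta k)))\<^sup>2) \<partial>count_space UNIV)"
    by (simp add: nn_integral_atoms)
  also have "\<dots> = (\<integral>\<^sup>+ x. weight x * ennreal ((norm (f x))\<^sup>2) \<partial>count_space UNIV)"
    by (rule nn_integral_bij_count_space) (rule involuntory_imp_bij, rule add_delta_cancel)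
  also have "\<dots> < \<infinity>"
    using assms by (simp add: gw_space_iff nn_integral_atoms)
  finally show "(\<integral>\<^sup>+ x. ennreal ((norm (gw_J_basis \<mu> c k f x))\<^sup>2) \<partial>completion \<mu>) < \<infinity>" .
qed

lemma gw_space_J_sigma:
  assumes "f \<in> gw_space \<H> \<mu> \<nu>"
  shows "gw_J_sigma_basis \<mu> c k f \<in> gw_space \<H> \<mu> \<nu>"
  by (rule gw_space_dominated[OF gw_space_J[OF assms, of k], where C = 1])
    (use gw_space_J[OF assms, of k] in \<open>auto simp: gw_J_sigma_basis_eq norm_scaleC norm_mult abs_bsign gw_space_iff
      fibre_scaleC\<close>)

text \<open>The identity \<open>J\<^sub>k J'\<^sub>k f (x) = \<i> (-1)\<^bsup>x k\<^esup> f (x)\<close>. The two Jacobian factors cancel,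
  as do the two unitary operators and the two signs \<open>jsign\<close>; the flip of the coordinate \<open>k\<close> turns
  \<open>\<i>\<^sup>3\<close> into \<open>\<i>\<close>.\<close>

lemma J_J_sigma:
  assumes f: "f \<in> gw_space \<H> \<mu> \<nu>" and x: "x \<in> atoms"
  shows "gw_J_basis \<mu> c k (gw_J_sigma_basis \<mu> c k f) x = (\<i> * bsign (x k)) *\<^sub>C f x"
proof -
  let ?y = "x + delta k"
  have y: "?y \<in> atoms" "\<nu> ?y = \<nu> x" using x by (simp_all add: atoms_delta nu_delta)
  have fx: "f x \<in> \<H> (\<nu> x)" using f x by (auto simp: gw_space_iff)
  have cf: "c k ?y (f x) \<in> \<H> (\<nu> x)" using c_closed[OF y(1)] fx y(2) by simp
  have sq: "sqrt (jac k x) * sqrt (jac k ?y) = 1"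
    unfolding real_sqrt_mult[symmetric] jac_delta[OF x] by (rule real_sqrt_one)
  have Jy: "gw_J_sigma_basis \<mu> c k f ?y
      = (- bsign (x k) * \<i> * (jsign k x * \<i> * sqrt (jac k ?y))) *\<^sub>C c k ?y (f x)"
    by (simp only: gw_J_sigma_basis_eq gw_J_basis_eq jsign_delta bsign_delta scaleC_scaleC
        add_delta_cancel of_real_minus)
  have "gw_J_basis \<mu> c k (gw_J_sigma_basis \<mu> c k f) x
      = ((jsign k x * \<i> * sqrt (jac k x)) *
          (- bsign (x k) * \<i> * (jsign k x * \<i> * sqrt (jac k ?y)))) *\<^sub>C f x"
    by (simp only: gw_J_basis_eq[of _ "gw_J_sigma_basis \<mu> c k f"] Jy c_scaleC[OF x cf]
        scaleC_scaleC c_inverse[OF x fx])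
  also have "(jsign k x * \<i> * sqrt (jac k x)) *
          (- bsign (x k) * \<i> * (jsign k x * \<i> * sqrt (jac k ?y)))
      = (- (\<i> * \<i>)) * \<i> * bsign (x k) * complex_of_real (jsign k x * jsign k x)
          * complex_of_real (sqrt (jac k x) * sqrt (jac k ?y))"
    by (simp only: of_real_mult of_real_minus mult_minus_left mult_minus_right mult_ac)
  also have "\<dots> = \<i> * bsign (x k)"
    by (simp only: jsign_square sq) simp
  finally show ?thesis .
qed

text \<open>A section is the mean-square limit of its restrictions to finite sets of atoms, so a closed
  subspace contains it as soon as it contains its values at the single atoms.\<close>

lemma closed_points:
  assumes W: "gw_closed_real_subspace \<H> \<mu> \<nu> W" and g: "g \<in> gw_space \<H> \<mu> \<nu>"
    and pt: "\<And>a. a \<in> atoms \<Longrightarrow> (\<lambda>x. if x = a then g a else 0) \<in> W"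
  shows "g \<in> W"
proof -
  have W_add: "\<And>f h. f \<in> W \<Longrightarrow> h \<in> W \<Longrightarrow> (\<lambda>x. f x + h x) \<in> W" and W_0: "(\<lambda>x. 0) \<in> W"
    using W by (simp_all add: gw_closed_real_subspace_def)
  have fin: "(\<lambda>x. if x \<in> S then g x else 0) \<in> W" if "finite S" "S \<subseteq> atoms" for S
    using that
  proof (induction S)
    case empty
    then show ?case using W_0 by simp
  next
    case (insert a S)
    then have "(\<lambda>x. (if x \<in> S then g x else 0) + (if x = a then g a else 0)) \<in> W"
      by (intro W_add pt) auto
    moreover have "(\<lambda>x. (if x \<in> S then g x else 0) + (if x = a then g a else 0))
        = (\<lambda>x. if x \<in> insert a S then g x else 0)"
      using insert.hyps(2) by auto
    ultimately show ?case by (simp only:)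
  qed
  define S where "S n = from_nat_into atoms ` {..<n}" for n :: nat
  have S: "finite (S n)" "S n \<subseteq> atoms" for n
    using from_nat_into[OF atoms_nonempty] by (auto simp: S_def)
  show ?thesis
  proof (rule closed_dominated[OF W _ g g])
    show "(\<lambda>x. if x \<in> S n then g x else 0) \<in> W" for n
      by (rule fin[OF S])
    show "norm (if x \<in> S n then g x else 0) \<le> norm (g x)" for n x by simp
    fix x assume "x \<in> atoms"
    then obtain m where m: "from_nat_into atoms m = x"
      using from_nat_into_surj[OF countable_atoms] by blast
    have "\<forall>\<^sub>F n in sequentially. (if x \<in> S n then g x else 0) = g x"
      using eventually_gt_at_top[of m]
    proof eventually_elim
      case (elim n)
      then have "x \<in> S n" unfolding S_def m[symmetric] by blast
      then show ?case by simp
    qed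
    then show "(\<lambda>n. if x \<in> S n then g x else 0) \<longlonglongrightarrow> g x"
      by (rule tendsto_eventually)
  qed
qed

section \<open>A complex irreducible module lives on one orbit\<close>

lemma gw_space_scaleC:
  assumes "f \<in> gw_space \<H> \<mu> \<nu>"
  shows "(\<lambda>x. a *\<^sub>C f x) \<in> gw_space \<H> \<mu> \<nu>"
  using assms by (rule gw_space_dominated[where C = "cmod a"])
    (use assms in \<open>auto simp: norm_scaleC gw_space_iff fibre_scaleC\<close>)

lemma gw_space_add:
  assumes f: "f \<in> gw_space \<H> \<mu> \<nu>" and g: "g \<in> gw_space \<H> \<mu> \<nu>"
  shows "(\<lambda>x. f x + g x) \<in> gw_space \<H> \<mu> \<nu>"
proof -
  have "ennreal ((norm (f x + g x))\<^sup>2)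
      \<le> 2 * (ennreal ((norm (f x))\<^sup>2) + ennreal ((norm (g x))\<^sup>2))" for x
  proof -
    have "(norm (f x + g x))\<^sup>2 \<le> (norm (f x) + norm (g x))\<^sup>2"
      by (intro power_mono norm_triangle_ineq) auto
    also have "\<dots> \<le> 2 * ((norm (f x))\<^sup>2 + (norm (g x))\<^sup>2)"
      using sum_squares_bound[of "norm (f x)" "norm (g x)"] by (simp add: power2_sum)
    finally have "ennreal ((norm (f x + g x))\<^sup>2)
        \<le> ennreal (2 * ((norm (f x))\<^sup>2 + (norm (g x))\<^sup>2))"
      by (rule ennreal_leI)
    then show ?thesis by (simp add: ennreal_mult)
  qed
  then have "(\<integral>\<^sup>+ x. ennreal ((norm (f x + g x))\<^sup>2) \<partial>completion \<mu>)
      \<le> (\<integral>\<^sup>+ x. 2 * (ennreal ((norm (f x))\<^sup>2) + ennreal ((norm (g x))\<^sup>2)) \<partial>completion \<mu>)"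
    by (intro nn_integral_mono)
  also have "\<dots> = 2 * ((\<integral>\<^sup>+ x. ennreal ((norm (f x))\<^sup>2) \<partial>completion \<mu>)
      + (\<integral>\<^sup>+ x. ennreal ((norm (g x))\<^sup>2) \<partial>completion \<mu>))"
    by (simp add: nn_integral_cmult nn_integral_add measurable_all)
  also have "\<dots> < \<infinity>"
    using f g by (simp add: gw_space_iff ennreal_mult_less_top)
  finally show ?thesis
    using f g by (auto simp: gw_space_iff intro: cvec.subspace_add[OF fibre_subspace])
qed

lemma fibre_nonzero: "\<exists>v\<in>\<H> (\<nu> x). v \<noteq> 0"
proof -
  obtain B where B: "B \<subseteq> \<H> (\<nu> x)"
      "\<forall>u\<in>B. \<forall>v\<in>B. cinner u v = (if u = v then 1 else 0)"
      "case \<nu> x of enat m \<Rightarrow> finite B \<and> card B = m | \<infinity> \<Rightarrow> infinite B"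
    using fibre_dim[OF nu_ge_1, of x] by (auto simp: has_hilbert_dim_def)
  have "B \<noteq> {}"
    using B(3) nu_ge_1[of x] by (auto split: enat.splits simp: one_enat_def)
  then obtain u where u: "u \<in> B" by blast
  then have "cinner u u = 1" using B(2) by simp
  then have "u \<noteq> 0" by (auto simp: cinner_self)
  then show ?thesis using u B(1) by blast
qed

lemma finite_diff_delta:
  "finite {j. (x + delta k) j \<noteq> a j} \<longleftrightarrow> finite {j. x j \<noteq> a j}"
proof -
  have 1: "finite {j. x j \<noteq> a j}" if "finite {j. (x + delta k) j \<noteq> a j}" for x
    using that by (rule_tac finite_subset[of _ "insert k {j. (x + delta k) j \<noteq> a j}"])
      (auto simp: add_delta_other simp del: plus_fun_apply)
  show ?thesis
    using 1[of x] 1[of "x + delta k"] by (auto simp del: plus_fun_apply)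
qed

text \<open>Two sequences are in the same orbit when they differ in finitely many coordinates. The sections
  supported on the orbit of an atom form a nonzero invariant closed complex subspace, which is the
  whole module only if there are no other atoms.\<close>

lemma single_orbit:
  assumes irr: "gw_irreducible_complex \<H> \<mu> \<nu> c \<sigma> e"
    and a: "a \<in> atoms" and b: "b \<in> atoms"
  shows "finite {j. b j \<noteq> a j}"
proof (rule ccontr)
  assume inf: "infinite {j. b j \<noteq> a j}"
  let ?off = "\<lambda>x. x \<in> atoms \<and> infinite {j. x j \<noteq> a j}"
  define V where "V = {f \<in> gw_space \<H> \<mu> \<nu>. \<forall>x. ?off x \<longrightarrow> f x = 0}"
  have "gw_closed_complex_subspace \<H> \<mu> \<nu> V"
    unfolding gw_closed_complex_subspace_def gw_closed_real_subspace_def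
  proof (intro conjI allI ballI impI)
    show "V \<subseteq> gw_space \<H> \<mu> \<nu>" by (auto simp: V_def)
    show "(\<lambda>x. 0) \<in> V" by (auto simp: V_def gw_space_iff fibre_0)
    show "(\<lambda>x. f x + g x) \<in> V" if "f \<in> V" "g \<in> V" for f g
      using that by (auto simp: V_def intro: gw_space_add)
    show scaleC: "(\<lambda>x. z *\<^sub>C f x) \<in> V" if "f \<in> V" for f z
      using that by (auto simp: V_def intro: gw_space_scaleC)
    show "(\<lambda>x. r *\<^sub>R f x) \<in> V" if "f \<in> V" for f and r :: real
      using scaleC[OF that, of "complex_of_real r"] by (simp add: scaleC_of_real)
    fix F g assume F: "\<forall>n. F n \<in> V" and g: "g \<in> gw_space \<H> \<mu> \<nu>" "l2_tendsto \<mu> F g"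
    have "g x = 0" if "?off x" for x
    proof -
      have "(\<lambda>n. 0) \<longlonglongrightarrow> g x"
        using l2_tendsto_pointwise[OF g(2), of x] F that by (simp add: V_def)
      then show ?thesis by (simp add: LIMSEQ_const_iff)
    qed
    then show "g \<in> V" using g(1) by (simp add: V_def)
  qed
  moreover have "gw_invariant \<H> \<mu> \<nu> c \<sigma> e V"
    unfolding gw_invariant_def
  proof (intro allI ballI impI)
    fix z f g assume f: "f \<in> V" and J: "gw_J \<H> \<mu> \<nu> c \<sigma> e z f g"
    have "g x = 0" if x: "?off x" for x
    proof -
      have "f (x + delta k) = 0" for k
        using f x by (simp add: V_def atoms_delta finite_diff_delta del: plus_fun_apply)
      then have "gw_J_basis \<mu> c k f x = 0" "gw_J_sigma_basis \<mu> c k f x = 0" for k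
        using x by (simp_all add: gw_J_sigma_basis_eq gw_J_basis_eq c_0)
      then have "(\<lambda>n. 0) \<longlonglongrightarrow> g x"
        using l2_tendsto_pointwise[OF conjunct2[OF J[unfolded gw_J_def]], of x] x by simp
      then show ?thesis by (simp add: LIMSEQ_const_iff)
    qed
    then show "g \<in> V" using J by (simp add: V_def gw_J_def)
  qed
  ultimately have V: "V = {f \<in> gw_space \<H> \<mu> \<nu>. AE x in \<mu>. f x = 0} \<or> V = gw_space \<H> \<mu> \<nu>"
    using irr by (simp add: gw_irreducible_complex_def)
  obtain v where v: "v \<in> \<H> (\<nu> a)" "v \<noteq> 0" using fibre_nonzero by blast
  have "(\<lambda>x. if x = a then v else 0) \<in> V"
    using gw_space_point[OF v(1)] by (auto simp: V_def)
  moreover have "\<not> (AE x in \<mu>. (if x = a then v else 0) = 0)"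
    using a v(2) by (auto simp: AE_iff_atoms)
  ultimately have V_all: "V = gw_space \<H> \<mu> \<nu>" using V by blast
  obtain w where w: "w \<in> \<H> (\<nu> b)" "w \<noteq> 0" using fibre_nonzero by blast
  have "(\<lambda>x. if x = b then w else 0) \<in> V"
    using gw_space_point[OF w(1)] V_all by simp
  then have "(if b = b then w else 0) = 0"
    using b inf by (simp only: V_def mem_Collect_eq) blast
  then show False using w(2) by simp
qed

end

section \<open>Invariant real subspaces\<close>

lemma unitary_basis_inner:
  assumes "orthogonal_complex_structure \<sigma>" "unitary_basis \<sigma> e"
  shows "inner (e k) (e l) = (if k = l then 1 else 0)"
    and "inner (e k) (\<sigma> (e l)) = 0"
    and "inner (\<sigma> (e k)) (e l) = 0"
    and "inner (\<sigma> (e k)) (\<sigma> (e l)) = (if k = l then 1 else 0)"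
proof -
  have h: "herm \<sigma> (e k) (e l) = (if k = l then 1 else 0)" for k l
    using assms(2) by (simp add: unitary_basis_def)
  show 1: "inner (e k) (e l) = (if k = l then 1 else 0)" for k l
    using arg_cong[OF h[of k l], of Re] by (simp add: herm_def split: if_splits)
  show 2: "inner (e k) (\<sigma> (e l)) = 0" for k l
    using arg_cong[OF h[of k l], of Im] by (simp add: herm_def split: if_splits)
  show "inner (\<sigma> (e k)) (e l) = 0"
    using 2[of l k] by (simp add: inner_commute)
  show "inner (\<sigma> (e k)) (\<sigma> (e l)) = (if k = l then 1 else 0)"
    using assms(1) 1 by (simp add: orthogonal_complex_structure_def)
qed

text \<open>A closed real subspace \<open>W\<close> of the module of a discrete triple that is invariant under all
  operators of the one-particle space.\<close>

locale invariant_real_subspace = discrete_gw_triple \<H> \<mu> \<nu> c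
  for \<H> :: "enat \<Rightarrow> 'h::{complex_hilbert,second_countable_topology} set"
    and \<mu> \<nu> and c :: "nat \<Rightarrow> seq \<Rightarrow> 'h \<Rightarrow> 'h" +
  fixes \<sigma> :: "'z::{real_inner,banach,second_countable_topology} \<Rightarrow> 'z"
    and e :: "nat \<Rightarrow> 'z" and W :: "(seq \<Rightarrow> 'h) set"
  assumes complex_structure: "orthogonal_complex_structure \<sigma>" and basis: "unitary_basis \<sigma> e"
    and closed: "gw_closed_real_subspace \<H> \<mu> \<nu> W" and invariant: "gw_invariant \<H> \<mu> \<nu> c \<sigma> e W"
begin

lemma W_space: "f \<in> W \<Longrightarrow> f \<in> gw_space \<H> \<mu> \<nu>"
  and W_add: "f \<in> W \<Longrightarrow> g \<in> W \<Longrightarrow> (\<lambda>x. f x + g x) \<in> W"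
  and W_scaleR: "f \<in> W \<Longrightarrow> (\<lambda>x. r *\<^sub>R f x) \<in> W"
  and W_0: "(\<lambda>x. 0) \<in> W"
  using closed by (auto simp: gw_closed_real_subspace_def)

lemma W_eq: "f \<in> W \<Longrightarrow> (\<And>x. x \<in> atoms \<Longrightarrow> g x = f x) \<Longrightarrow> g \<in> W"
  by (rule closed_saturated[OF closed])

text \<open>For a basis vector the partial sums in the definition of its operator are eventually
  constant.\<close>

lemma W_generators:
  assumes f: "f \<in> W"
  shows "gw_J_basis \<mu> c k f \<in> W" and "gw_J_sigma_basis \<mu> c k f \<in> W"
proof -
  note inn = unitary_basis_inner[OF complex_structure basis]
  have conv: "l2_tendsto \<mu> F g" if "\<And>n x. n > k \<Longrightarrow> F n x = g x" for F and g :: "seq \<Rightarrow> 'h"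
    unfolding l2_tendsto_def
  proof (rule tendsto_eventually)
    show "\<forall>\<^sub>F n in sequentially.
        (\<integral>\<^sup>+ x. ennreal ((norm (F n x - g x))\<^sup>2) \<partial>completion \<mu>) = 0"
      using eventually_gt_at_top[of k] by eventually_elim (simp add: that)
  qed
  have "gw_J \<H> \<mu> \<nu> c \<sigma> e (e k) f (gw_J_basis \<mu> c k f)"
    unfolding gw_J_def
    by (intro conjI gw_space_J W_space f conv)
      (simp add: inn if_distrib[of "\<lambda>r. r *\<^sub>R _"] cong: if_cong)
  then show "gw_J_basis \<mu> c k f \<in> W"
    using invariant f unfolding gw_invariant_def by blast
  have "gw_J \<H> \<mu> \<nu> c \<sigma> e (\<sigma> (e k)) f (gw_J_sigma_basis \<mu> c k f)"
    unfolding gw_J_def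
    by (intro conjI gw_space_J_sigma W_space f conv)
      (simp add: inn if_distrib[of "\<lambda>r. r *\<^sub>R _"] cong: if_cong)
  then show "gw_J_sigma_basis \<mu> c k f \<in> W"
    using invariant f unfolding gw_invariant_def by blast
qed

lemma W_sign: "f \<in> W \<Longrightarrow> (\<lambda>x. (\<i> * bsign (x k)) *\<^sub>C f x) \<in> W"
  by (rule W_eq[OF W_generators(1)[OF W_generators(2), of _ k k]])
    (assumption, rule J_J_sigma[symmetric, OF W_space])

lemma W_sign_sign:
  assumes "f \<in> W"
  shows "(\<lambda>x. (bsign (x j) * bsign (x k)) *\<^sub>R f x) \<in> W"
proof (rule W_eq[OF W_scaleR[OF W_sign[OF W_sign[OF assms]], of "- 1"]])
  fix x
  have "(\<i> * bsign (x j)) *\<^sub>C (\<i> * bsign (x k)) *\<^sub>C f x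
      = complex_of_real (- (bsign (x j) * bsign (x k))) *\<^sub>C f x"
    by (simp add: scaleC_scaleC algebra_simps)
  then show "(bsign (x j) * bsign (x k)) *\<^sub>R f x
      = - 1 *\<^sub>R (\<i> * bsign (x j)) *\<^sub>C (\<i> * bsign (x k)) *\<^sub>C f x"
    by (simp only: scaleC_of_real) simp
qed

text \<open>The restriction is half the sum of the identity and a multiplication by signs.\<close>

lemma W_restrict_agree:
  assumes "f \<in> W"
  shows "(\<lambda>x. if x j = a j \<longleftrightarrow> x k = a k then f x else 0) \<in> W"
proof (rule W_eq)
  show "(\<lambda>x. (1/2) *\<^sub>R (f x + (bsign (a j) * bsign (a k)) *\<^sub>R
      (bsign (x j) * bsign (x k)) *\<^sub>R f x)) \<in> W"
    by (intro W_scaleR W_add W_sign_sign assms)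
  have "v = (1/2) *\<^sub>R (v + v)" for v :: 'h
    by (simp flip: scaleR_2)
  then show "(if x j = a j \<longleftrightarrow> x k = a k then f x else 0)
      = (1/2) *\<^sub>R (f x + (bsign (a j) * bsign (a k)) *\<^sub>R (bsign (x j) * bsign (x k)) *\<^sub>R f x)" for x
    by (cases "x j"; cases "x k"; cases "a j"; cases "a k") (simp_all add: bsign_def)
qed

text \<open>Restricting successively to agreement of coordinate \<open>k\<close> with coordinate \<open>0\<close> leaves, in the
  limit, only \<open>a\<close> and the sequence that differs from \<open>a\<close> in all coordinates.\<close>

lemma W_restrict_pair:
  assumes f: "f \<in> W"
  shows "(\<lambda>x. if \<forall>k. x 0 = a 0 \<longleftrightarrow> x k = a k then f x else 0) \<in> W"
proof -
  have n: "(\<lambda>x. if \<forall>k<n. x 0 = a 0 \<longleftrightarrow> x k = a k then f x else 0) \<in> W" for n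
  proof (induction n)
    case 0
    then show ?case using f by simp
  next
    case (Suc n)
    show ?case
      by (rule W_eq[OF W_restrict_agree[OF Suc, of 0 a n]]) (simp add: less_Suc_eq, blast)
  qed
  show ?thesis
  proof (rule closed_dominated[OF closed n _ W_space[OF f]])
    show "(\<lambda>x. if \<forall>k. x 0 = a 0 \<longleftrightarrow> x k = a k then f x else 0) \<in> gw_space \<H> \<mu> \<nu>"
      using gw_space_restrict[OF W_space[OF f], of "{x. \<forall>k. x 0 = a 0 \<longleftrightarrow> x k = a k}"] by simp
    fix x
    have "\<forall>\<^sub>F n in sequentially. (if \<forall>k<n. x 0 = a 0 \<longleftrightarrow> x k = a k then f x else 0)
        = (if \<forall>k. x 0 = a 0 \<longleftrightarrow> x k = a k then f x else 0)"
    proof (cases "\<forall>k. x 0 = a 0 \<longleftrightarrow> x k = a k")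
      case False
      then obtain m where "\<not> (x 0 = a 0 \<longleftrightarrow> x m = a m)" by blast
      then have "\<not> (\<forall>k<n. x 0 = a 0 \<longleftrightarrow> x k = a k)" if "n > m" for n
        using that by blast
      then show ?thesis
        using False by (intro eventually_mono[OF eventually_gt_at_top[of m]]) (simp only: if_False)
    qed auto
    then show "(\<lambda>n. if \<forall>k<n. x 0 = a 0 \<longleftrightarrow> x k = a k then f x else 0)
        \<longlonglongrightarrow> (if \<forall>k. x 0 = a 0 \<longleftrightarrow> x k = a k then f x else 0)"
      by (rule tendsto_eventually)
  qed auto
qed

text \<open>If the atoms form one orbit, only one of these two sequences is an atom.\<close>

lemma W_restrict_point:
  assumes orbit: "\<And>x y. x \<in> atoms \<Longrightarrow> y \<in> atoms \<Longrightarrow> finite {j. x j \<noteq> y j}"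
    and f: "f \<in> W" and a: "a \<in> atoms"
  shows "(\<lambda>x. if x = a then f a else 0) \<in> W"
proof (rule W_eq[OF W_restrict_pair[OF f, of a]])
  fix x assume x: "x \<in> atoms"
  have "x 0 = a 0"
    if "\<forall>k. x 0 = a 0 \<longleftrightarrow> x k = a k"
  proof (rule ccontr)
    assume "x 0 \<noteq> a 0"
    then have "{j. x j \<noteq> a j} = UNIV" using that by auto
    then show False using orbit[OF x a] by simp
  qed
  then have "(\<forall>k. x 0 = a 0 \<longleftrightarrow> x k = a k) \<longleftrightarrow> x = a" by auto
  then show "(if x = a then f a else 0) = (if \<forall>k. x 0 = a 0 \<longleftrightarrow> x k = a k then f x else 0)"
    by simp
qed

text \<open>At a single atom multiplication by \<open>\<i>\<close> is, up to a real sign, the product of two generators.\<close>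

lemma W_complex:
  assumes orbit: "\<And>x y. x \<in> atoms \<Longrightarrow> y \<in> atoms \<Longrightarrow> finite {j. x j \<noteq> y j}"
  shows "gw_closed_complex_subspace \<H> \<mu> \<nu> W"
  unfolding gw_closed_complex_subspace_def
proof (intro conjI closed allI ballI)
  fix z f assume f: "f \<in> W"
  have "(\<lambda>x. \<i> *\<^sub>C f x) \<in> W"
  proof (rule closed_points[OF closed gw_space_scaleC[OF W_space[OF f]]])
    fix a assume a: "a \<in> atoms"
    have "(\<lambda>x. if x = a then f a else 0) \<in> W"
      by (rule W_restrict_point[OF _ f a]) (rule orbit)
    then have "(\<lambda>x. bsign (a 0) *\<^sub>R (\<i> * bsign (x 0)) *\<^sub>C (if x = a then f a else 0)) \<in> W"
      by (rule W_scaleR[OF W_sign])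
    moreover have i: "bsign b *\<^sub>R (\<i> * bsign b) *\<^sub>C v = \<i> *\<^sub>C v" for b and v :: 'h
      by (simp add: bsign_def)
    ultimately show "(\<lambda>x. if x = a then \<i> *\<^sub>C f a else 0) \<in> W"
      using W_eq by (simp add: i if_distrib)
  qed
  then have "(\<lambda>x. Re z *\<^sub>R f x + Im z *\<^sub>R \<i> *\<^sub>C f x) \<in> W"
    by (intro W_add W_scaleR f)
  moreover have "Re z *\<^sub>R v + Im z *\<^sub>R \<i> *\<^sub>C v = z *\<^sub>C v" for v :: 'h
  proof -
    have "Re z *\<^sub>R v + Im z *\<^sub>R \<i> *\<^sub>C v = (complex_of_real (Re z) + complex_of_real (Im z) * \<i>) *\<^sub>C v"
      by (simp only: scaleC_add_left scaleC_of_real scaleC_scaleC[symmetric])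
    also have "complex_of_real (Re z) + complex_of_real (Im z) * \<i> = z"
      by (simp add: complex_eq_iff)
    finally show ?thesis .
  qed
  ultimately show "(\<lambda>x. z *\<^sub>C f x) \<in> W" by simp
qed

text \<open>The generators move the values at one atom to every point of its orbit: \<open>J\<^sub>k\<close> maps the sections
  supported on \<open>b + delta k\<close> onto those supported on \<open>b\<close>, so induction on the set of coordinates
  in which \<open>b\<close> differs from \<open>a\<close> applies.\<close>

lemma W_point_orbit:
  assumes W: "gw_closed_complex_subspace \<H> \<mu> \<nu> W" and a: "a \<in> atoms"
    and all: "\<And>v. v \<in> \<H> (\<nu> a) \<Longrightarrow> (\<lambda>x. if x = a then v else 0) \<in> W"
    and b: "finite {j. b j \<noteq> a j}" and w: "w \<in> \<H> (\<nu> b)"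
  shows "(\<lambda>x. if x = b then w else 0) \<in> W"
  using b w
proof (induction "{j. b j \<noteq> a j}" arbitrary: b w rule: finite_induct)
  case empty
  then have "b = a" by auto
  then show ?case using all empty.prems by simp
next
  case (insert k D)
  let ?d = "b + delta k"
  have "finite {j. b j \<noteq> a j}"
    using insert.hyps(1,4) by (metis finite_insert)
  then have b: "b \<in> atoms"
    using a atoms_orbit by blast
  then have d: "?d \<in> atoms" "\<nu> ?d = \<nu> b"
    by (simp_all add: atoms_delta nu_delta)
  have "b k \<noteq> a k" using insert.hyps(4) by blast
  then have "b k + 1 = a k" by (cases "b k"; cases "a k") simp_all
  then have dk: "?d k = a k" by (simp only: add_delta_self)
  have D: "D = {j. ?d j \<noteq> a j}"
  proof (rule set_eqI)
    fix j show "j \<in> D \<longleftrightarrow> j \<in> {j. ?d j \<noteq> a j}"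
    proof (cases "j = k")
      case True
      then show ?thesis using dk insert.hyps(2) by (simp only: mem_Collect_eq) simp
    next
      case False
      then have "?d j = b j" by (rule add_delta_other)
      moreover have "j \<in> D \<longleftrightarrow> b j \<noteq> a j" using False insert.hyps(4) by blast
      ultimately show ?thesis by (simp only: mem_Collect_eq)
    qed
  qed
  define \<kappa> where "\<kappa> = jsign k b * \<i> * sqrt (jac k b)"
  have "jac k b \<noteq> 0" using jac_delta[OF b, of k] by auto
  then have \<kappa>: "\<kappa> \<noteq> 0"
    using abs_jsign[of k b] by (auto simp: \<kappa>_def)
  \<comment> \<open>the preimage of \<open>w\<close> under \<open>J\<^sub>k\<close>, whose value at \<open>b\<close> is \<open>\<kappa>\<close> times \<open>c k b\<close>\<close>
  let ?v = "(1 / \<kappa>) *\<^sub>C c k ?d w"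
  have cw: "c k ?d w \<in> \<H> (\<nu> b)"
    using c_closed[OF d(1)] insert.prems d(2) by simp
  then have "?v \<in> \<H> (\<nu> ?d)" using d(2) by (simp add: fibre_scaleC)
  then have "(\<lambda>x. if x = ?d then ?v else 0) \<in> W"
    by (rule insert.hyps(3)[OF D])
  then have "gw_J_basis \<mu> c k (\<lambda>x. if x = ?d then ?v else 0) \<in> W"
    by (rule W_generators)
  then show ?case
  proof (rule W_eq)
    fix x assume x: "x \<in> atoms"
    have "x + delta k = ?d \<longleftrightarrow> x = b" by (metis add_delta_cancel)
    moreover have "\<kappa> *\<^sub>C c k b ?v = w"
      using \<kappa> c_inverse[OF b insert.prems] by (simp add: c_scaleC[OF b cw] scaleC_scaleC)
    ultimately show "(if x = b then w else 0) = gw_J_basis \<mu> c k (\<lambda>x. if x = ?d then ?v else 0) x"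
      using c_0[OF x] by (auto simp: gw_J_basis_eq \<kappa>_def)
  qed
qed

end

section \<open>Irreducibility\<close>

context discrete_gw_triple
begin

lemma irreducible_real:
  fixes \<sigma> :: "'z::{real_inner,banach,second_countable_topology} \<Rightarrow> 'z"
  assumes "orthogonal_complex_structure \<sigma>" "unitary_basis \<sigma> e"
    and irr: "gw_irreducible_complex \<H> \<mu> \<nu> c \<sigma> e"
  shows "gw_irreducible_real \<H> \<mu> \<nu> c \<sigma> e"
  unfolding gw_irreducible_real_def
proof (intro allI impI)
  fix W assume W: "gw_closed_real_subspace \<H> \<mu> \<nu> W" "gw_invariant \<H> \<mu> \<nu> c \<sigma> e W"
  interpret invariant_real_subspace \<H> \<mu> \<nu> c \<sigma> e W
    by unfold_locales fact+
  have "gw_closed_complex_subspace \<H> \<mu> \<nu> W"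
    by (rule W_complex) (rule single_orbit[OF irr])
  then show "W = {f \<in> gw_space \<H> \<mu> \<nu>. AE x in \<mu>. f x = 0} \<or> W = gw_space \<H> \<mu> \<nu>"
    using irr W(2) by (simp add: gw_irreducible_complex_def)
qed

text \<open>One-dimensional fibres over a single orbit give a module that is irreducible over the complex
  numbers, for any cocycle \<open>c\<close>.\<close>

lemma irreducible_complex_one_dimensional:
  fixes \<sigma> :: "'z::{real_inner,banach,second_countable_topology} \<Rightarrow> 'z"
  assumes "orthogonal_complex_structure \<sigma>" "unitary_basis \<sigma> e"
    and orbit: "\<And>x y. x \<in> atoms \<Longrightarrow> y \<in> atoms \<Longrightarrow> finite {j. x j \<noteq> y j}"
    and one: "\<And>x. \<nu> x = 1"
  shows "gw_irreducible_complex \<H> \<mu> \<nu> c \<sigma> e"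
  unfolding gw_irreducible_complex_def
proof (intro allI impI)
  fix W assume W: "gw_closed_complex_subspace \<H> \<mu> \<nu> W" "gw_invariant \<H> \<mu> \<nu> c \<sigma> e W"
  then have "gw_closed_real_subspace \<H> \<mu> \<nu> W"
    by (simp add: gw_closed_complex_subspace_def)
  interpret invariant_real_subspace \<H> \<mu> \<nu> c \<sigma> e W
    by unfold_locales fact+
  show "W = {f \<in> gw_space \<H> \<mu> \<nu>. AE x in \<mu>. f x = 0} \<or> W = gw_space \<H> \<mu> \<nu>"
  proof (cases "\<forall>f\<in>W. \<forall>x\<in>atoms. f x = 0")
    case True
    have "f \<in> W \<longleftrightarrow> f \<in> gw_space \<H> \<mu> \<nu> \<and> (\<forall>x\<in>atoms. f x = 0)" for f
      using True W_space[of f] W_eq[OF W_0, of f] by blast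
    then have "W = {f \<in> gw_space \<H> \<mu> \<nu>. AE x in \<mu>. f x = 0}"
      by (simp add: AE_iff_atoms set_eq_iff)
    then show ?thesis ..
  next
    case False
    then obtain f a where f: "f \<in> W" and a: "a \<in> atoms" and fa: "f a \<noteq> 0" by blast
    have "(\<lambda>x. if x = a then v else 0) \<in> W" if v: "v \<in> \<H> (\<nu> a)" for v
    proof -
      have "f a \<in> \<H> (\<nu> a)" using W_space[OF f] a by (simp add: gw_space_iff)
      then obtain z where z: "v = z *\<^sub>C f a"
        using hilbert_dim_1_multiple[of "\<H> (\<nu> a)" "f a" v] fibre_dim[of 1] v fa one by auto
      have "(\<lambda>x. z *\<^sub>C (if x = a then f a else 0)) \<in> W"
        using W(1) W_restrict_point[OF _ f a] orbit by (simp add: gw_closed_complex_subspace_def)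
      then show ?thesis by (rule W_eq) (simp add: z)
    qed
    then have pt: "(\<lambda>x. if x = b then w else 0) \<in> W" if "b \<in> atoms" "w \<in> \<H> (\<nu> b)" for b w
      by (rule W_point_orbit[OF W(1) a _ orbit[OF that(1) a] that(2)])
    have "g \<in> W" if g: "g \<in> gw_space \<H> \<mu> \<nu>" for g
    proof (rule closed_points[OF closed g])
      fix b assume b: "b \<in> atoms"
      then have "g b \<in> \<H> (\<nu> b)" using g by (simp add: gw_space_iff)
      with b show "(\<lambda>x. if x = b then g b else 0) \<in> W" by (rule pt)
    qed
    then show ?thesis using W_space by blast
  qed
qed

end

section \<open>The Fock representation\<close>

lemma space_fock: "space fock_measure = UNIV" and sets_fock: "sets fock_measure = sets seq_space"
  by (simp_all add: fock_measure_def space_seq_space)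

lemma fock_measure_eq:
  assumes "E \<in> sets seq_space"
  shows "emeasure fock_measure E = emeasure (count_space Delta) (E \<inter> Delta)"
  unfolding fock_measure_def
  using assms by (subst emeasure_distr) (auto simp: space_seq_space)

lemma null_sets_fock: "E \<in> null_sets fock_measure \<longleftrightarrow> E \<in> sets seq_space \<and> E \<inter> Delta = {}"
  by (auto simp: null_sets_def sets_fock fock_measure_eq emeasure_count_space_eq_0)

lemma Compl_Delta_sets: "- Delta \<in> sets seq_space"
  using Delta_sets by (metis Compl_eq_Diff_UNIV sets.compl_sets space_seq_space)

lemma AE_fock: "(\<And>x. x \<in> Delta \<Longrightarrow> P x) \<Longrightarrow> AE x in fock_measure. P x"
  by (rule AE_I'[of "- Delta"]) (auto simp: null_sets_fock Compl_Delta_sets)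

lemma sigma_finite_fock: "sigma_finite_measure fock_measure"
proof
  show "\<exists>A. countable A \<and> A \<subseteq> sets fock_measure \<and> \<Union> A = space fock_measure \<and>
      (\<forall>a\<in>A. emeasure fock_measure a \<noteq> \<infinity>)"
    by (intro exI[of _ "insert (- Delta) ((\<lambda>d. {d}) ` Delta)"])
      (auto simp: countable_Delta sets_fock Compl_Delta_sets singleton_sets space_fock fock_measure_off_Delta
        fock_measure_singleton)
qed

lemma gw_triple_fock: "gw_triple \<H> fock_measure (\<lambda>x. 1) (\<lambda>k x v. v)"
proof -
  have "emeasure fock_measure UNIV \<noteq> 0"
  proof
    assume "emeasure fock_measure UNIV = 0"
    then have "UNIV \<in> null_sets fock_measure"
      using sets.top[of fock_measure] by (simp add: null_sets_def space_fock)
    then show False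
      using delta_Delta by (auto simp: null_sets_fock)
  qed
  moreover have "quasi_invariant fock_measure"
    unfolding quasi_invariant_def
  proof (intro ballI set_eqI)
    fix d E assume d: "d \<in> Delta"
    have m: "(\<lambda>x. x + d) \<in> measurable fock_measure fock_measure"
      using measurable_translation by (simp add: measurable_cong_sets[OF sets_fock sets_fock])
    have "(\<lambda>x. x + d) -` E \<inter> Delta = {} \<longleftrightarrow> E \<inter> Delta = {}"
      using Delta_add[OF _ d] add_delta_cancel by fastforce
    moreover have "(\<lambda>x. x + d) -` E \<in> sets seq_space" if "E \<in> sets seq_space"
      using measurable_sets[OF m, of E] that by (simp add: sets_fock space_fock)
    ultimately show "E \<in> null_sets (translate fock_measure d) \<longleftrightarrow> E \<in> null_sets fock_measure"
      unfolding translate_def null_sets_distr_iff[OF m] null_sets_fock space_fock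
      by (auto simp: sets_fock)
  qed
  ultimately show ?thesis
    by (simp add: gw_triple_def space_fock sets_fock sigma_finite_fock unitary_on_def)
qed

lemma discrete_fock: "discrete_measure fock_measure"
  unfolding discrete_measure_def
  by (rule exI[of _ Delta]) (simp add: countable_Delta AE_fock)

theorem corollary3p7:
  fixes \<sigma> :: "'z::{real_inner,banach,second_countable_topology} \<Rightarrow> 'z"
    and e :: "nat \<Rightarrow> 'z"
    and \<H> :: "enat \<Rightarrow> 'h::{complex_hilbert,second_countable_topology} set"
  assumes "\<not> (\<exists>B::'z set. finite B \<and> span B = UNIV)"
    and "orthogonal_complex_structure \<sigma>"
    and "unitary_basis \<sigma> e"
    and "\<And>n. n \<ge> 1 \<Longrightarrow> closed_csubspace (\<H> n) \<and> has_hilbert_dim (\<H> n) n"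
  shows "(\<forall>\<mu> \<nu> c. gw_triple \<H> \<mu> \<nu> c \<longrightarrow> discrete_measure \<mu> \<longrightarrow>
            gw_irreducible_complex \<H> \<mu> \<nu> c \<sigma> e \<longrightarrow> gw_irreducible_real \<H> \<mu> \<nu> c \<sigma> e) \<and>
         (gw_triple \<H> fock_measure (\<lambda>x. 1) (\<lambda>k x v. v) \<and> discrete_measure fock_measure \<and>
            gw_irreducible_complex \<H> fock_measure (\<lambda>x. 1) (\<lambda>k x v. v) \<sigma> e \<and>
            gw_irreducible_real \<H> fock_measure (\<lambda>x. 1) (\<lambda>k x v. v) \<sigma> e)"
proof -
  have loc: "discrete_gw_triple \<H> \<mu> \<nu> c" if "gw_triple \<H> \<mu> \<nu> c" "discrete_measure \<mu>" for \<mu> \<nu> c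
    using that assms(4) by unfold_locales auto
  have real: "gw_irreducible_real \<H> \<mu> \<nu> c \<sigma> e"
    if "gw_triple \<H> \<mu> \<nu> c" "discrete_measure \<mu>" "gw_irreducible_complex \<H> \<mu> \<nu> c \<sigma> e" for \<mu> \<nu> c
    using discrete_gw_triple.irreducible_real[OF loc] assms(2,3) that by blast
  interpret fock: discrete_gw_triple \<H> fock_measure "\<lambda>x. 1" "\<lambda>k x v. v"
    by (rule loc[OF gw_triple_fock discrete_fock])
  have "AE x in fock_measure. x \<in> Delta"
    by (rule AE_fock)
  then have atoms: "fock.atoms \<subseteq> Delta"
    by (auto simp: fock.AE_iff_atoms)
  have "finite {j. x j \<noteq> y j}" if "x \<in> fock.atoms" "y \<in> fock.atoms" for x y
  proof (rule finite_subset)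
    show "{j. x j \<noteq> y j} \<subseteq> {j. x j = 1} \<union> {j. y j = 1}" by auto
    show "finite ({j. x j = 1} \<union> {j. y j = 1})"
      using that atoms by (auto simp: Delta_def)
  qed
  then have "gw_irreducible_complex \<H> fock_measure (\<lambda>x. 1) (\<lambda>k x v. v) \<sigma> e"
    by (intro fock.irreducible_complex_one_dimensional assms(2,3)) auto
  then show ?thesis
    using real gw_triple_fock discrete_fock by blast
qed

end
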